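(* Let $m,n,d,N,r\ge 1$ be integers and let $\mathbf{u}^{(1)},\dots,\mathbf{u}^{(N)}\in\mathbb{R}^m$ be sampling points chosen such that the Vandermonde-like matrix $\mathbf{A}\in\mathbb{R}^{\delta\times N}$ defined in the context satisfies $\operatorname{rank}\mathbf{A}=M:=\binom{m+d-1}{d-1}$. Let $\mathcal{L}_{\mathcal{Q}}\subset\mathbb{R}^{n\times m\times\delta}$ be the linear subspace of all tensors $\mathcal{Q}(\mathbf{p})$, and $\mathcal{L}_{\mathcal{J}}\subset\mathbb{R}^{n\times m\times N}$ the linear subspace of all tensors $\mathcal{J}(\mathbf{p})$, where $\mathbf{p}$ ranges over the polynomial maps $\mathbb{R}^m\to\mathbb{R}^n$ of total degree at most $d$ without constant terms. Let $\mathbf{f}:\mathbb{R}^m\to\mathbb{R}^n$ be a polynomial map of total degree at most $d$ without constant terms. Then the following three statements are equivalent: 1. $\mathbf{f}$ admits a decomposition $\mathbf{f}(\mathbf{u})=\mathbf{w}_1g_1(\mathbf{v}_1^\top\mathbf{u})+\cdots+\mathbf{w}_rg_r(\mathbf{v}_r^\top\mathbf{u})$ with $\mathbf{w}_k\in\mathbb{R}^n$, $\mathbf{v}_k\in\mathbb{R}^m$, and $g_k$ real univariate polynomials of degree at most $d$ with zero constant term; 2. the tensor $\mathcal{Q}(\mathbf{f})$ admits the structured CP decomposition $$\mathcal{Q}(\mathbf{f})=\mathcal{Q}_1+\cdots+\mathcal{Q}_r,\qquad\operatorname{rank}(\mathcal{Q}_k)=1,\quad\mathcal{Q}_k\in\mathcal{L}_{\mathcal{Q}}\quad(k=1,\dots,r);$$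 3. the tensor $\mathcal{J}(\mathbf{f})$ admits the structured CP decomposition $$\mathcal{J}(\mathbf{f})=\mathcal{J}_1+\cdots+\mathcal{J}_r,\qquad\operatorname{rank}(\mathcal{J}_k)=1,\quad\mathcal{J}_k\in\mathcal{L}_{\mathcal{J}}\quad(k=1,\dots,r).$$
   Context: Tensor of unfoldings. Let $\delta=\sum_{k=1}^{d}m^{k-1}$. Every real polynomial $p$ in $\mathbf{u}=(u_1,\dots,u_m)^\top$ of total degree at most $d$ with zero constant term can be written uniquely as $p(\mathbf{u})=\sum_{s=1}^{d}\sum_{i_1,\dots,i_s=1}^{m}\Psi^{(s)}_{i_1,\dots,i_s}u_{i_1}\cdots u_{i_s}$ with $\Psi^{(s)}\in\mathbb{R}^{m\times\cdots\times m}$ a symmetric tensor of order $s$ (a vector for $s=1$). Let $\Psi^{(s)}_{(1)}\in\mathbb{R}^{m\times m^{s-1}}$ be the first-mode unfolding, whose $i$-th row is the (column-major) vectorization of the slice $\Psi^{(s)}_{i,:,\dots,:}$. Define $\Psi(p)=[\,\Psi^{(1)}\mid\Psi^{(2)}\mid\Psi^{(3)}_{(1)}\mid\cdots\mid\Psi^{(d)}_{(1)}\,]\in\mathbb{R}^{m\times\delta}$. For a polynomial map $\mathbf{p}=(p_1,\dots,p_n)^\top$ of degree at most $d$ without constant terms, $\mathcal{Q}(\mathbf{p})\in\mathbb{R}^{n\times m\times\delta}$ has slices $\mathcal{Q}(\mathbf{p})_{i,:,:}=\Psi(p_i)$. Tensor of Jacobians. $\mathcal{J}(\mathbf{p})\in\mathbb{R}^{n\times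 m\times N}$ is given by $\mathcal{J}(\mathbf{p})_{i,j,l}=\frac{\partial p_i}{\partial u_j}(\mathbf{u}^{(l)})$. Vandermonde-like matrix. $\mathbf{A}\in\mathbb{R}^{\delta\times N}$ has $j$-th column $$\mathbf{A}_{:,j}=\big[\,1\mid 2(\mathbf{u}^{(j)})^\top\mid 3(\mathbf{u}^{(j)}\otimes\mathbf{u}^{(j)})^\top\mid\cdots\mid d(\underbrace{\mathbf{u}^{(j)}\otimes\cdots\otimes\mathbf{u}^{(j)}}_{d-1})^\top\,\big]^\top,$$ where $\otimes$ is the Kronecker product. The rank of a third-order real tensor is its CP rank: the smallest number of terms in an expression of it as a sum of outer products $\mathbf{a}\circ\mathbf{b}\circ\mathbf{c}$, where $(\mathbf{a}\circ\mathbf{b}\circ\mathbf{c})_{i,j,k}=a_ib_jc_k$.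
   Formalization: For r = 1 the map f is additionally assumed not to be identically zero: for f = 0 and r = 1 statement 1 holds, but statements 2 and 3 fail because the zero tensor has CP rank 0, not 1. *)

theory Defs
  imports
    "HOL-Analysis.Derivative"
    "HOL-Combinatorics.List_Permutation"
    "HOL-Computational_Algebra.Polynomial"
    "Jordan_Normal_Form.DL_Rank"
begin

text \<open>Exponent vectors of total degree between 1 and \<open>d\<close>: the constant monomial is excluded.\<close>

definition exponents :: "nat \<Rightarrow> nat \<Rightarrow> (nat \<Rightarrow> nat) set" where
  "exponents m d =
     {\<alpha>. (\<forall>i\<ge>m. \<alpha> i = 0) \<and> 1 \<le> (\<Sum>i<m. \<alpha> i) \<and> (\<Sum>i<m. \<alpha> i) \<le> d}"

definition polynomial_fun :: "nat \<Rightarrow> nat \<Rightarrow> (real vec \<Rightarrow> real) \<Rightarrow> bool" where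
  "polynomial_fun m d p \<longleftrightarrow>
     (\<exists>c. \<forall>u \<in> carrier_vec m.
        p u = (\<Sum>\<alpha>\<in>exponents m d. c \<alpha> * (\<Prod>i<m. (u $ i) ^ \<alpha> i)))"

definition polynomial_maps :: "nat \<Rightarrow> nat \<Rightarrow> nat \<Rightarrow> (real vec \<Rightarrow> real vec) set" where
  "polynomial_maps n m d =
     {p. (\<forall>u \<in> carrier_vec m. p u \<in> carrier_vec n) \<and>
         (\<forall>i<n. polynomial_fun m d (\<lambda>u. p u $ i))}"

definition partial_deriv :: "nat \<Rightarrow> (real vec \<Rightarrow> real) \<Rightarrow> real vec \<Rightarrow> real" where
  "partial_deriv j p u = deriv (\<lambda>t. p (u + t \<cdot>\<^sub>v unit_vec (dim_vec u) j)) 0"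

text \<open>A tensor in \<open>\<real>\<^bsup>n\<times>m\<times>K\<^esup>\<close> is a function of three (0-based) indices that
  vanishes outside the index box, so that equality of tensors is equality of functions.\<close>

type_synonym tensor3 = "nat \<Rightarrow> nat \<Rightarrow> nat \<Rightarrow> real"

definition tensor3 :: "nat \<Rightarrow> nat \<Rightarrow> nat \<Rightarrow> tensor3 \<Rightarrow> tensor3" where
  "tensor3 n m K F = (\<lambda>i j k. if i < n \<and> j < m \<and> k < K then F i j k else 0)"

definition outer3 :: "real vec \<Rightarrow> real vec \<Rightarrow> real vec \<Rightarrow> tensor3" where
  "outer3 a b c =
     tensor3 (dim_vec a) (dim_vec b) (dim_vec c) (\<lambda>i j k. a $ i * b $ j * c $ k)"

definition tensor_sum :: "nat \<Rightarrow> (nat \<Rightarrow> tensor3) \<Rightarrow> tensor3" where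
  "tensor_sum r T = (\<lambda>i j k. \<Sum>q<r. T q i j k)"

definition cp_rank :: "nat \<Rightarrow> nat \<Rightarrow> nat \<Rightarrow> tensor3 \<Rightarrow> nat" where
  "cp_rank n m K T =
     (LEAST R. \<exists>a b c.
        (\<forall>q<R. a q \<in> carrier_vec n \<and> b q \<in> carrier_vec m \<and> c q \<in> carrier_vec K) \<and>
        T = tensor_sum R (\<lambda>q. outer3 (a q) (b q) (c q)))"

definition multi_indices :: "nat \<Rightarrow> nat \<Rightarrow> nat list set" where
  "multi_indices m s = {is. length is = s \<and> set is \<subseteq> {..<m}}"

definition symmetric_tensors :: "nat \<Rightarrow> nat \<Rightarrow> (nat list \<Rightarrow> real) set" where
  "symmetric_tensors m s =
     {T. (\<forall>is. is \<notin> multi_indices m s \<longrightarrow> T is = 0) \<and>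
         (\<forall>is \<in> multi_indices m s. \<forall>\<pi>. \<pi> permutes {..<s} \<longrightarrow> T (permute_list \<pi> is) = T is)}"

text \<open>The unique family of symmetric tensors of orders \<open>1, \<dots>, d\<close> representing \<open>p\<close>
  (the irrelevant orders are fixed to be zero, which makes the family unique as a function).\<close>

definition coeff_tensors ::
  "nat \<Rightarrow> nat \<Rightarrow> (real vec \<Rightarrow> real) \<Rightarrow> nat \<Rightarrow> nat list \<Rightarrow> real" where
  "coeff_tensors m d p =
     (THE \<Psi>. (\<forall>s \<in> {1..d}. \<Psi> s \<in> symmetric_tensors m s) \<and>
          (\<forall>s. s \<notin> {1..d} \<longrightarrow> \<Psi> s = (\<lambda>is. 0)) \<and>
          (\<forall>u \<in> carrier_vec m.
             p u = (\<Sum>s=1..d. \<Sum>is\<in>multi_indices m s.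
                      \<Psi> s is * prod_list (map (\<lambda>i. u $ i) is))))"

text \<open>The multi-index of length \<open>k\<close> at position \<open>q\<close> of the column-major order: the first index
  varies fastest, so the indices are the base-\<open>m\<close> digits of \<open>q\<close>, least significant first.\<close>

definition colmajor_index :: "nat \<Rightarrow> nat \<Rightarrow> nat \<Rightarrow> nat list" where
  "colmajor_index m k q = map (\<lambda>l. q div m ^ l mod m) [0..<k]"

definition unfolding1 :: "nat \<Rightarrow> nat \<Rightarrow> (nat list \<Rightarrow> real) \<Rightarrow> real mat" where
  "unfolding1 m s T =
     mat m (m ^ (s - 1)) (\<lambda>(i, q). T (i # colmajor_index m (s - 1) q))"

definition Delta :: "nat \<Rightarrow> nat \<Rightarrow> nat" where
  "Delta m d = (\<Sum>k=1..d. m ^ (k - 1))"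

definition Psi :: "nat \<Rightarrow> nat \<Rightarrow> (real vec \<Rightarrow> real) \<Rightarrow> real mat" where
  "Psi m d p =
     mat_of_cols m (concat (map (\<lambda>s. cols (unfolding1 m s (coeff_tensors m d p s))) [1..<Suc d]))"

definition Q_tensor :: "nat \<Rightarrow> nat \<Rightarrow> nat \<Rightarrow> (real vec \<Rightarrow> real vec) \<Rightarrow> tensor3" where
  "Q_tensor n m d p =
     tensor3 n m (Delta m d) (\<lambda>i j k. Psi m d (\<lambda>u. p u $ i) $$ (j, k))"

definition Q_space :: "nat \<Rightarrow> nat \<Rightarrow> nat \<Rightarrow> tensor3 set" where
  "Q_space n m d = Q_tensor n m d ` polynomial_maps n m d"

definition J_tensor ::
  "nat \<Rightarrow> nat \<Rightarrow> nat \<Rightarrow> (nat \<Rightarrow> real vec) \<Rightarrow> (real vec \<Rightarrow> real vec) \<Rightarrow> tensor3" where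
  "J_tensor n m N U p =
     tensor3 n m N (\<lambda>i j l. partial_deriv j (\<lambda>u. p u $ i) (U l))"

definition J_space ::
  "nat \<Rightarrow> nat \<Rightarrow> nat \<Rightarrow> nat \<Rightarrow> (nat \<Rightarrow> real vec) \<Rightarrow> tensor3 set" where
  "J_space n m d N U = J_tensor n m N U ` polynomial_maps n m d"

definition kronecker :: "real vec \<Rightarrow> real vec \<Rightarrow> real vec" where
  "kronecker a b =
     vec (dim_vec a * dim_vec b) (\<lambda>q. a $ (q div dim_vec b) * b $ (q mod dim_vec b))"

fun kronecker_power :: "real vec \<Rightarrow> nat \<Rightarrow> real vec" where
  "kronecker_power u 0 = vec 1 (\<lambda>_. 1)"
| "kronecker_power u (Suc k) = kronecker u (kronecker_power u k)"

definition vandermonde_col :: "nat \<Rightarrow> real vec \<Rightarrow> real vec" where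
  "vandermonde_col d u =
     vec_of_list (concat (map (\<lambda>s. list_of_vec (real s \<cdot>\<^sub>v kronecker_power u (s - 1))) [1..<Suc d]))"

definition vandermonde_mat :: "nat \<Rightarrow> nat \<Rightarrow> nat \<Rightarrow> (nat \<Rightarrow> real vec) \<Rightarrow> real mat" where
  "vandermonde_mat m d N U =
     mat_of_cols (Delta m d) (map (\<lambda>j. vandermonde_col d (U j)) [0..<N])"

end

theory Submission
  imports Defs
begin

text \<open>All three conditions say that the map is a sum of \<open>r\<close> ridge maps \<open>w g(v\<^sup>T u)\<close>, so it suffices to show,
  for the tensor of unfoldings and for the tensor of Jacobians, that the tensor determines the
  polynomial map additively, and that the tensor of a map is an outer product iff the map is a ridge map.

  For unfoldings, a symmetric tensor with \<open>T(j, is) = b\<^sub>j C(is)\<close> is a multiple of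
  \<open>b \<otimes> \<dots> \<otimes> b\<close>, since by symmetry the factorisation applies to every index.

  For Jacobians, the rank condition makes evaluation at the sampling points injective on polynomials of
  degree less than \<open>d\<close>. The minors \<open>b\<^sub>k \<partial>\<^sub>j p - b\<^sub>j \<partial>\<^sub>k p\<close> vanish at the sampling points, hence everywhere, so
  the gradient is parallel to \<open>b\<close> and \<open>p\<close> is constant along the hyperplanes orthogonal to \<open>b\<close>.\<close>

section \<open>Monomials\<close>

text \<open>The number \<open>(m + d - 1) choose (d - 1)\<close> counts the monomials of degree at
  most d - 1, the possible degree of a partial derivative. Rows of the Vandermonde matrix whose
  multi-indices are rearrangements of each other coincide, so this number bounds the rank, and the
  hypothesis asks for the largest possible value.

  Polynomials are functions here, whereas the tensor of unfoldings consists of coefficients selected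
  by a definite description. Linear independence of monomials is the bridge: it gives the uniqueness
  behind that description.

  The equivalence is delicate because each term must have CP rank exactly 1, while a summand
  \<open>w g(v\<^sup>T u)\<close> may be zero. Zero summands can be repaired if another summand is
  nonzero or if r \<ge> 2. In the remaining case, r = 1 and f = 0, the ridge decomposition exists
  but neither tensor decomposition does, since the zero tensor has CP rank 0; this is why f is
  assumed nonzero when r = 1.\<close>

definition monomial :: "nat \<Rightarrow> (nat \<Rightarrow> nat) \<Rightarrow> real vec \<Rightarrow> real" where
  "monomial m \<alpha> u = (\<Prod>i<m. (u $ i) ^ \<alpha> i)"

text \<open>Unlike in \<open>exponents\<close>, the zero exponent is allowed, because partial
  derivatives may have constant terms.\<close>

definition exponents_upto :: "nat \<Rightarrow> nat \<Rightarrow> (nat \<Rightarrow> nat) set" where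
  "exponents_upto m D = {\<alpha>. (\<forall>i\<ge>m. \<alpha> i = 0) \<and> (\<Sum>i<m. \<alpha> i) \<le> D}"

text \<open>Stars and bars: the slack \<open>D - (\<Sum>i<m. \<alpha> i)\<close> becomes an extra
  last entry, which turns the inequality into an equation for lists of length m + 1.\<close>

lemma card_exponents_upto: "card (exponents_upto m D) = (m + D) choose D"
proof -
  let ?L = "{l::nat list. length l = Suc m \<and> sum_list l = D}"
  let ?\<phi> = "\<lambda>(l::nat list) i. if i < m then l ! i else 0"
  have split: "sum_list l = (\<Sum>i<m. l ! i) + l ! m" if "length l = Suc m" for l :: "nat list"
    using that by (simp add: sum_list_sum_nth atLeast0LessThan)
  have "bij_betw ?\<phi> ?L (exponents_upto m D)"
  proof (rule bij_betwI')
    fix l l' assume l: "l \<in> ?L" and l': "l' \<in> ?L"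
    show "(?\<phi> l = ?\<phi> l') = (l = l')"
    proof
      assume eq: "?\<phi> l = ?\<phi> l'"
      have nth: "l ! i = l' ! i" if "i < m" for i
        using fun_cong[OF eq, of i] that by simp
      then have "(\<Sum>i<m. l ! i) = (\<Sum>i<m. l' ! i)" by simp
      then have "l ! m = l' ! m"
        using l l' split[of l] split[of l'] by simp
      with nth l l' show "l = l'"
        by (intro nth_equalityI) (auto simp: less_Suc_eq)
    qed auto
  next
    fix l assume "l \<in> ?L"
    then show "?\<phi> l \<in> exponents_upto m D"
      using split[of l] by (auto simp: exponents_upto_def)
  next
    fix \<alpha> assume \<alpha>: "\<alpha> \<in> exponents_upto m D"
    let ?l = "map \<alpha> [0..<m] @ [D - (\<Sum>i<m. \<alpha> i)]"
    have "?l \<in> ?L"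
      using \<alpha> by (auto simp: exponents_upto_def sum_list_sum_nth atLeast0LessThan nth_append)
    moreover have "\<alpha> = ?\<phi> ?l"
      using \<alpha> by (auto simp: exponents_upto_def nth_append)
    ultimately show "\<exists>l\<in>?L. \<alpha> = ?\<phi> l" by blast
  qed
  from bij_betw_same_card[OF this] show ?thesis
    using card_length_sum_list[of "Suc m" D] by (simp add: add.commute)
qed

lemma finite_exponents_upto [simp]: "finite (exponents_upto m D)"
  by (rule card_ge_0_finite) (simp add: card_exponents_upto)

lemma exponents_subset: "exponents m d \<subseteq> exponents_upto m d"
  by (auto simp: exponents_def exponents_upto_def)

lemma finite_exponents [simp]: "finite (exponents m d)"
  using finite_subset[OF exponents_subset] by simp

text \<open>Induction removes the least significant digit, the residue modulo \<open>B\<close>. This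
  makes the exponents produced by the Kronecker substitution below distinct.\<close>

lemma digits_unique:
  fixes a b :: "nat \<Rightarrow> nat"
  assumes "\<forall>i<m. a i < B" "\<forall>i<m. b i < B"
    and "(\<Sum>i<m. a i * B ^ i) = (\<Sum>i<m. b i * B ^ i)" and "i < m"
  shows "a i = b i"
  using assms
proof (induction m arbitrary: a b i)
  case (Suc m)
  have shift: "(\<Sum>i<Suc m. a i * B ^ i) = a 0 + B * (\<Sum>i<m. a (Suc i) * B ^ i)" for a :: "nat \<Rightarrow> nat"
    by (subst sum.lessThan_Suc_shift) (simp add: sum_distrib_left mult_ac)
  have a0: "a 0 < B" "b 0 < B" using Suc.prems by auto
  have eq: "a 0 + B * (\<Sum>i<m. a (Suc i) * B ^ i) = b 0 + B * (\<Sum>i<m. b (Suc i) * B ^ i)"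
    using Suc.prems(3) unfolding shift .
  from arg_cong[OF eq, of "\<lambda>x. x mod B"] a0 have 0: "a 0 = b 0" by simp
  with eq a0 have "(\<Sum>i<m. a (Suc i) * B ^ i) = (\<Sum>i<m. b (Suc i) * B ^ i)" by simp
  then have "a (Suc j) = b (Suc j)" if "j < m" for j
    using Suc.IH[of "\<lambda>i. a (Suc i)" "\<lambda>i. b (Suc i)" j] Suc.prems that by simp
  with 0 Suc.prems(4) show ?case by (cases i) auto
qed simp

text \<open>Kronecker substitution \<open>u\<^sub>i = t\<^bsup>B^i\<^esup>\<close> with a large base \<open>B\<close> turns distinct monomials into
  distinct powers of \<open>t\<close>.\<close>

lemma monomials_independent:
  assumes S: "finite S" "\<And>\<alpha> i. \<alpha> \<in> S \<Longrightarrow> i \<ge> m \<Longrightarrow> \<alpha> i = 0"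
    and zero: "\<And>u. u \<in> carrier_vec m \<Longrightarrow> (\<Sum>\<alpha>\<in>S. c \<alpha> * monomial m \<alpha> u) = 0"
    and "\<alpha> \<in> S"
  shows "c \<alpha> = 0"
proof -
  \<comment> \<open>A crude bound: the sum of all exponents occurring in \<open>S\<close> exceeds or
    equals each of them, so all of them are base-\<open>B\<close> digits.\<close>
  define B where "B = Suc (\<Sum>\<alpha>\<in>S. \<Sum>i<m. \<alpha> i)"
  define key where "key = (\<lambda>\<alpha>. \<Sum>i<m. \<alpha> i * B ^ i)"
  have bound: "\<beta> i < B" if "\<beta> \<in> S" "i < m" for \<beta> i
  proof -
    have "\<beta> i \<le> (\<Sum>i<m. \<beta> i)" using that by (intro member_le_sum) auto
    also have "\<dots> \<le> (\<Sum>\<alpha>\<in>S. \<Sum>i<m. \<alpha> i)"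
      using that S by (intro member_le_sum[of \<beta> S "\<lambda>\<alpha>. \<Sum>i<m. \<alpha> i"]) auto
    finally show ?thesis by (simp add: B_def)
  qed
  have inj: "\<beta> = \<gamma>" if "\<beta> \<in> S" "\<gamma> \<in> S" "key \<beta> = key \<gamma>" for \<beta> \<gamma>
  proof
    fix i
    show "\<beta> i = \<gamma> i"
      using digits_unique[of m \<beta> B \<gamma> i] bound S(2)[of \<beta> i] S(2)[of \<gamma> i] that
      by (cases "i < m") (auto simp: key_def)
  qed
  define P where "P = (\<Sum>\<beta>\<in>S. monom (c \<beta>) (key \<beta>))"
  have "poly P t = 0" for t
  proof -
    let ?u = "Matrix.vec m (\<lambda>i. t ^ B ^ i)"
    have "monomial m \<beta> ?u = t ^ key \<beta>" for \<beta>
      by (simp add: monomial_def key_def power_sum power_mult[symmetric] mult.commute)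
    with zero[of ?u] show ?thesis
      by (simp add: P_def poly_sum poly_monom)
  qed
  then have "P = 0" using poly_all_0_iff_0 by blast
  have "coeff P (key \<alpha>) = (\<Sum>\<beta>\<in>S. if \<beta> = \<alpha> then c \<beta> else 0)"
    unfolding P_def coeff_sum using inj \<open>\<alpha> \<in> S\<close> by (intro sum.cong) auto
  also have "\<dots> = c \<alpha>" using S \<open>\<alpha> \<in> S\<close> by simp
  finally show ?thesis using \<open>P = 0\<close> by simp
qed

text \<open>Collecting like terms: \<open>\<beta>\<close> gives the exponent vector of each summand.
  It is applied to multi-indices with the same counts and to differentiated monomials.\<close>

lemma sum_monomials_fibre:
  assumes "finite X" "finite S" "\<beta> ` X \<subseteq> S"
  shows "(\<Sum>x\<in>X. y x * monomial m (\<beta> x) u)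
    = (\<Sum>\<gamma>\<in>S. (\<Sum>x\<in>{x\<in>X. \<beta> x = \<gamma>}. y x) * monomial m \<gamma> u)"
proof -
  have "(\<Sum>x\<in>X. y x * monomial m (\<beta> x) u)
      = (\<Sum>\<gamma>\<in>S. \<Sum>x\<in>{x\<in>X. \<beta> x = \<gamma>}. y x * monomial m (\<beta> x) u)"
    by (rule sum.group[symmetric]) (use assms in auto)
  then show ?thesis by (simp add: sum_distrib_right)
qed

section \<open>Polynomial functions of bounded degree, constants included\<close>

definition polydeg :: "nat \<Rightarrow> nat \<Rightarrow> (real vec \<Rightarrow> real) \<Rightarrow> bool" where
  "polydeg m D q \<longleftrightarrow>
     (\<exists>c. \<forall>u\<in>carrier_vec m. q u = (\<Sum>\<alpha>\<in>exponents_upto m D. c \<alpha> * monomial m \<alpha> u))"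

text \<open>The degree bound is asked only of terms with nonzero coefficient: differentiating a
  monomial free of the variable gives coefficient 0, but truncated subtraction then leaves its
  exponent vector, and hence its degree, unchanged.\<close>

lemma polydeg_sum_monomials:
  assumes "finite X" "\<And>x. x \<in> X \<Longrightarrow> y x \<noteq> 0 \<Longrightarrow> \<beta> x \<in> exponents_upto m D"
  shows "polydeg m D (\<lambda>u. \<Sum>x\<in>X. y x * monomial m (\<beta> x) u)"
proof -
  let ?X = "{x\<in>X. y x \<noteq> 0}"
  have "(\<Sum>x\<in>X. y x * monomial m (\<beta> x) u) = (\<Sum>x\<in>?X. y x * monomial m (\<beta> x) u)" for u
    using assms(1) by (intro sum.mono_neutral_right) auto
  also have "(\<Sum>x\<in>?X. y x * monomial m (\<beta> x) u) = (\<Sum>\<gamma>\<in>exponents_upto m D. (\<Sum>x\<in>{x\<in>?X. \<beta> x = \<gamma>}. y x) * monomial m \<gamma> u)" for u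
    using assms by (intro sum_monomials_fibre) auto
  finally have "\<And>u. (\<Sum>x\<in>X. y x * monomial m (\<beta> x) u)
      = (\<Sum>\<gamma>\<in>exponents_upto m D. (\<Sum>x\<in>{x\<in>?X. \<beta> x = \<gamma>}. y x) * monomial m \<gamma> u)" .
  then show ?thesis unfolding polydeg_def
    by (intro exI[of _ "\<lambda>\<gamma>. \<Sum>x\<in>{x\<in>?X. \<beta> x = \<gamma>}. y x"]) simp
qed

lemma polydeg_diff:
  assumes "polydeg m D p" "polydeg m D q"
  shows "polydeg m D (\<lambda>u. a * p u - b * q u)"
proof -
  obtain c e where "\<forall>u\<in>carrier_vec m. p u = (\<Sum>\<alpha>\<in>exponents_upto m D. c \<alpha> * monomial m \<alpha> u)"
    "\<forall>u\<in>carrier_vec m. q u = (\<Sum>\<alpha>\<in>exponents_upto m D. e \<alpha> * monomial m \<alpha> u)"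
    using assms unfolding polydeg_def by auto
  then show ?thesis unfolding polydeg_def
    by (intro exI[of _ "\<lambda>\<alpha>. a * c \<alpha> - b * e \<alpha>"])
      (simp add: left_diff_distrib sum_subtractf sum_distrib_left mult.assoc)
qed

text \<open>The column space is a subspace of \<open>span B\<close>, whose dimension is at most the
  size of its generating set; \<open>B\<close> may be dependent.\<close>

lemma (in vec_space) rank_le_card_spanning:
  assumes A: "A \<in> carrier_mat n nc" and B: "finite B" "B \<subseteq> carrier_vec n"
    and cols: "set (cols A) \<subseteq> span B"
  shows "rank A \<le> card B"
proof -
  have BV: "B \<subseteq> carrier V" using B by simp
  have colsV: "set (cols A) \<subseteq> carrier V" using cols_dim A by fastforce
  have subB: "subspace class_ring (span B) V"
    and subA: "subspace class_ring (span (set (cols A))) V"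
    using span_is_subspace BV colsV by auto
  have vsB: "vectorspace class_ring (span_vs B)" using subspace_is_vs[OF subB] .
  have "span (set (cols A)) \<subseteq> span B"
    by (rule span_is_subset[OF cols span_is_submodule[OF B(2)]])
  from nested_subspaces[OF subB subA this]
  have "subspace class_ring (span (set (cols A))) (span_vs B)" .
  then have "rank A \<le> vectorspace.dim class_ring (span_vs B)"
    unfolding rank_def
    using vectorspace.subspace_dim[OF vsB] fin_dim_span[OF B(1)] BV fin_dim_span_cols[OF A] by simp
  also have "\<dots> \<le> card B"
    using vectorspace.gen_ge_dim[OF vsB B(1)] in_own_span[OF B(2)]
      span_li_not_depend(1)[OF in_own_span[OF B(2)]] span_is_submodule[OF B(2)] by simp
  finally show ?thesis .
qed

section \<open>Symmetric coefficient tensors\<close>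

lemma finite_multi_indices [simp]: "finite (multi_indices m s)"
  using finite_lists_length_eq[of "{..<m}" s]
  by (simp add: multi_indices_def conj_commute)

text \<open>From here on \<open>count_list\<close> serves as the exponent vector of a multi-index;
  two multi-indices are rearrangements of each other iff it agrees on them.\<close>

lemma prod_list_eq_monomial:
  assumes "set is \<subseteq> {..<m}"
  shows "prod_list (map (\<lambda>i. u $ i) is) = monomial m (count_list is) u"
  using assms
proof (induction "is")
  case (Cons i "is")
  have "monomial m (count_list (i # is)) u
      = (\<Prod>j<m. (if j = i then u $ i else 1) * u $ j ^ count_list is j)"
    unfolding monomial_def by (intro prod.cong) auto
  also have "\<dots> = u $ i * monomial m (count_list is) u"
    using Cons.prems by (simp add: prod.distrib monomial_def)
  finally show ?case using Cons by (simp del: count_list.simps)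
qed (simp add: monomial_def)

lemma count_list_multi_index:
  assumes "is \<in> multi_indices m s"
  shows "(\<Sum>i<m. count_list is i) = s" and "i \<ge> m \<Longrightarrow> count_list is i = 0"
  using assms sum_count_set[of "is" "{..<m}"]
  by (auto simp: multi_indices_def count_list_0_iff)

lemma multi_index_with_count:
  assumes "\<forall>i\<ge>m. \<alpha> i = 0"
  obtains "is" where "is \<in> multi_indices m (\<Sum>i<m. \<alpha> i)" "count_list is = \<alpha>"
proof -
  define L where "L = (\<lambda>m. concat (map (\<lambda>i. replicate (\<alpha> i) i) [0..<m]))"
  have count: "count_list (L k) j = (if j < k then \<alpha> j else 0)" for k j
  proof (induction k)
    case (Suc k)
    have "count_list (replicate n k) j = (if j = k then n else 0)" for n
      by (induction n) auto
    with Suc show ?case by (auto simp: L_def count_list_append)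
  qed (simp add: L_def)
  have "set (L m) \<subseteq> {..<m}" by (auto simp: L_def)
  moreover have "count_list (L m) = \<alpha>" using count assms by fastforce
  moreover have "(\<Sum>i<m. count_list (L m) i) = length (L m)"
    using \<open>set (L m) \<subseteq> {..<m}\<close> by (intro sum_count_set) auto
  ultimately show ?thesis
    by (intro that[of "L m"]) (auto simp: multi_indices_def)
qed

lemma count_list_eq_iff_mset: "count_list xs = count_list ys \<longleftrightarrow> mset xs = mset ys"
  by (auto simp: multiset_eq_iff count_mset fun_eq_iff)

lemma symmetric_tensor_mset_cong:
  assumes "T \<in> symmetric_tensors m s" "is \<in> multi_indices m s" "mset js = mset is"
  shows "T js = T is"
proof -
  obtain \<pi> where "\<pi> permutes {..<length is}" "permute_list \<pi> is = js"
    using mset_eq_permutation[OF assms(3)] by blast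
  with assms(1,2) show ?thesis
    by (auto simp: symmetric_tensors_def multi_indices_def)
qed

text \<open>The condition under the definite description in \<open>coeff_tensors\<close>, named so
  that existence and uniqueness can be proved separately.\<close>

definition coeff_family ::
  "nat \<Rightarrow> nat \<Rightarrow> (real vec \<Rightarrow> real) \<Rightarrow> (nat \<Rightarrow> nat list \<Rightarrow> real) \<Rightarrow> bool" where
  "coeff_family m d p \<Psi> \<longleftrightarrow>
     (\<forall>s \<in> {1..d}. \<Psi> s \<in> symmetric_tensors m s) \<and>
     (\<forall>s. s \<notin> {1..d} \<longrightarrow> \<Psi> s = (\<lambda>is. 0)) \<and>
     (\<forall>u \<in> carrier_vec m.
        p u = (\<Sum>s=1..d. \<Sum>is\<in>multi_indices m s. \<Psi> s is * prod_list (map (\<lambda>i. u $ i) is)))"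

abbreviation multi_indices_upto :: "nat \<Rightarrow> nat \<Rightarrow> (nat \<times> nat list) set" where
  "multi_indices_upto m d \<equiv> (SIGMA s:{1..d}. multi_indices m s)"

lemma sum_multi_indices_monomial:
  "(\<Sum>s=1..d. \<Sum>is\<in>multi_indices m s. \<Psi> s is * prod_list (map (\<lambda>i. u $ i) is))
   = (\<Sum>x\<in>multi_indices_upto m d. \<Psi> (fst x) (snd x) * monomial m (count_list (snd x)) u)"
  unfolding sum.Sigma[OF finite_atLeastAtMost ballI[OF finite_multi_indices]]
  by (intro sum.cong) (auto simp: multi_indices_def prod_list_eq_monomial)

lemma finite_multi_indices_upto [simp]: "finite (multi_indices_upto m d)"
  by auto

lemma count_list_multi_indices_upto:
  "(\<lambda>x. count_list (snd x)) ` multi_indices_upto m d = exponents m d"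
proof
  show "(\<lambda>x. count_list (snd x)) ` multi_indices_upto m d \<subseteq> exponents m d"
    by (auto simp: exponents_def count_list_multi_index)
  show "exponents m d \<subseteq> (\<lambda>x. count_list (snd x)) ` multi_indices_upto m d"
  proof
    fix \<alpha> assume \<alpha>: "\<alpha> \<in> exponents m d"
    then obtain "is" where "is \<in> multi_indices m (\<Sum>i<m. \<alpha> i)" "count_list is = \<alpha>"
      using multi_index_with_count[of m \<alpha>] by (auto simp: exponents_def)
    with \<alpha> show "\<alpha> \<in> (\<lambda>x. count_list (snd x)) ` multi_indices_upto m d"
      by (intro image_eqI[of _ _ "(\<Sum>i<m. \<alpha> i, is)"]) (auto simp: exponents_def)
  qed
qed

lemma constant_sum_eq_0D:
  fixes g :: "'a \<Rightarrow> real"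
  assumes "finite F" "x \<in> F" "\<And>y. y \<in> F \<Longrightarrow> g y = g x" "sum g F = 0"
  shows "g x = 0"
proof -
  have "sum g F = real (card F) * g x" using assms(3) by simp
  moreover have "card F \<noteq> 0" using assms(1,2) by (auto simp: card_eq_0_iff)
  ultimately show ?thesis using assms(4) by simp
qed

text \<open>The coefficient of a monomial is the sum of the tensor entries over the fibre of
  \<open>count_list\<close>. For the difference of two families this sum is 0 by independence of
  monomials, and symmetry makes the difference constant on the fibre, so each entry is 0.\<close>

lemma coeff_family_unique:
  assumes "coeff_family m d p \<Psi>" "coeff_family m d p \<Psi>'"
  shows "\<Psi> = \<Psi>'"
proof (intro ext)
  fix s "is"
  let ?X = "multi_indices_upto m d"
  show "\<Psi> s is = \<Psi>' s is"
  proof (cases "(s, is) \<in> ?X")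
    case False
    then show ?thesis
      using assms by (cases "s \<in> {1..d}") (auto simp: coeff_family_def symmetric_tensors_def)
  next
    case True
    define \<Theta> where "\<Theta> = (\<lambda>x. \<Psi> (fst x) (snd x) - \<Psi>' (fst x) (snd x))"
    let ?F = "{x \<in> ?X. count_list (snd x) = count_list is}"
    have sum0: "(\<Sum>\<gamma>\<in>exponents m d. (\<Sum>x\<in>{x\<in>?X. count_list (snd x) = \<gamma>}. \<Theta> x) * monomial m \<gamma> u) = 0"
      if "u \<in> carrier_vec m" for u
    proof -
      have "(\<Sum>\<gamma>\<in>exponents m d. (\<Sum>x\<in>{x\<in>?X. count_list (snd x) = \<gamma>}. \<Theta> x) * monomial m \<gamma> u)
          = (\<Sum>x\<in>?X. \<Theta> x * monomial m (count_list (snd x)) u)"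
        by (rule sum_monomials_fibre[OF finite_multi_indices_upto finite_exponents
            equalityD1[OF count_list_multi_indices_upto], symmetric])
      also have "\<dots> = p u - p u"
        using assms that unfolding coeff_family_def sum_multi_indices_monomial
        by (simp add: \<Theta>_def left_diff_distrib sum_subtractf)
      finally show ?thesis by simp
    qed
    have mem: "count_list is \<in> exponents m d"
      using True count_list_multi_indices_upto[where m = m and d = d] by force
    have zero: "sum \<Theta> ?F = 0"
      by (intro monomials_independent[where c = "\<lambda>\<gamma>. \<Sum>x\<in>{x\<in>?X. count_list (snd x) = \<gamma>}. \<Theta> x",
            OF finite_exponents _ sum0 mem]) (auto simp: exponents_def)
    have const: "\<Theta> x = \<Theta> (s, is)" if x: "x \<in> ?F" for x
    proof -
      obtain s' js where [simp]: "x = (s', js)" by fastforce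
      have ms: "mset js = mset is" using x by (simp add: count_list_eq_iff_mset)
      \<comment> \<open>The counts determine the length, so a fibre does not mix tensors of
        different orders.\<close>
      then have "length js = length is" by (metis size_mset)
      with x True have "s' = s" by (auto simp: multi_indices_def)
      moreover have "\<Psi> s js = \<Psi> s is" "\<Psi>' s js = \<Psi>' s is"
        using assms True ms symmetric_tensor_mset_cong[of _ m s "is" js]
        by (auto simp: coeff_family_def)
      ultimately show ?thesis by (simp add: \<Theta>_def)
    qed
    have "(s, is) \<in> ?F" "finite ?F" using True by auto
    from constant_sum_eq_0D[OF this(2,1) const zero] have "\<Theta> (s, is) = 0" .
    then show ?thesis by (simp add: \<Theta>_def)
  qed
qed

text \<open>Symmetrisation: the coefficient of a monomial is distributed equally among the
  multi-indices of that monomial, whose number is a multinomial coefficient.\<close>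

lemma coeff_family_exists:
  assumes "polynomial_fun m d p"
  shows "\<exists>\<Psi>. coeff_family m d p \<Psi>"
proof -
  obtain c where c: "\<forall>u \<in> carrier_vec m. p u = (\<Sum>\<alpha>\<in>exponents m d. c \<alpha> * monomial m \<alpha> u)"
    using assms unfolding polynomial_fun_def monomial_def by blast
  let ?X = "multi_indices_upto m d"
  define F where "F = (\<lambda>\<gamma>. {x \<in> ?X. count_list (snd x) = \<gamma>})"
  define \<Psi> where "\<Psi> = (\<lambda>s is. if (s, is) \<in> ?X
      then c (count_list is) / real (card (F (count_list is))) else 0)"
  have "\<Psi> s \<in> symmetric_tensors m s" for s
    unfolding symmetric_tensors_def
  proof (intro CollectI conjI allI impI ballI)
    fix "is" \<pi> assume "is \<in> multi_indices m s" "\<pi> permutes {..<s}"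
    then have "mset (permute_list \<pi> is) = mset is"
      by (intro mset_permute_list) (simp add: multi_indices_def)
    then have "count_list (permute_list \<pi> is) = count_list is"
      and "permute_list \<pi> is \<in> multi_indices m s \<longleftrightarrow> is \<in> multi_indices m s"
      using mset_eq_setD by (auto simp: count_list_eq_iff_mset multi_indices_def)
    then show "\<Psi> s (permute_list \<pi> is) = \<Psi> s is" by (simp add: \<Psi>_def)
  qed (simp add: \<Psi>_def)
  moreover have "\<Psi> s = (\<lambda>is. 0)" if "s \<notin> {1..d}" for s
    using that by (auto simp: \<Psi>_def)
  moreover have "p u = (\<Sum>s=1..d. \<Sum>is\<in>multi_indices m s. \<Psi> s is * prod_list (map (\<lambda>i. u $ i) is))"
    if "u \<in> carrier_vec m" for u
  proof -
    have "(\<Sum>x\<in>F \<gamma>. \<Psi> (fst x) (snd x)) = c \<gamma>" if "\<gamma> \<in> exponents m d" for \<gamma>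
    proof -
      have "F \<gamma> \<noteq> {}"
        using that count_list_multi_indices_upto[where m = m and d = d] by (force simp: F_def)
      then have "card (F \<gamma>) \<noteq> 0" by (simp add: F_def)
      moreover have "(\<Sum>x\<in>F \<gamma>. \<Psi> (fst x) (snd x)) = (\<Sum>x\<in>F \<gamma>. c \<gamma> / real (card (F \<gamma>)))"
        by (intro sum.cong refl) (auto simp: F_def \<Psi>_def)
      ultimately show ?thesis by simp
    qed
    then have "p u = (\<Sum>\<gamma>\<in>exponents m d. (\<Sum>x\<in>F \<gamma>. \<Psi> (fst x) (snd x)) * monomial m \<gamma> u)"
      using c \<open>u \<in> carrier_vec m\<close> by simp
    also have "\<dots> = (\<Sum>x\<in>?X. \<Psi> (fst x) (snd x) * monomial m (count_list (snd x)) u)"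
      unfolding F_def
      by (rule sum_monomials_fibre[OF finite_multi_indices_upto finite_exponents
            equalityD1[OF count_list_multi_indices_upto], symmetric])
    finally show ?thesis unfolding sum_multi_indices_monomial .
  qed
  ultimately show ?thesis unfolding coeff_family_def by blast
qed

lemma coeff_tensors_eqI:
  assumes "coeff_family m d p \<Psi>"
  shows "coeff_tensors m d p = \<Psi>"
  unfolding coeff_tensors_def coeff_family_def[symmetric]
  by (rule the_equality) (use assms coeff_family_unique in auto)

lemma coeff_family_coeff_tensors:
  assumes "polynomial_fun m d p"
  shows "coeff_family m d p (coeff_tensors m d p)"
  using coeff_family_exists[OF assms] coeff_tensors_eqI by auto

section \<open>Columns of the unfoldings and of the Vandermonde matrix\<close>

text \<open>A common labelling, by order and multi-index, of the columns of \<open>Psi\<close> and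
  the rows of the Vandermonde matrix. It replaces all arithmetic with block offsets.\<close>

definition col_indices :: "nat \<Rightarrow> nat \<Rightarrow> (nat \<times> nat list) list" where
  "col_indices m d =
     concat (map (\<lambda>s. map (\<lambda>q. (s, colmajor_index m (s - 1) q)) [0..<m ^ (s - 1)]) [1..<Suc d])"

lemma length_col_indices: "length (col_indices m d) = Delta m d"
  unfolding col_indices_def Delta_def length_concat map_map o_def length_map length_upt
  by (subst interv_sum_list_conv_sum_set_nat) (auto intro: sum.cong)

lemma colmajor_index_Suc:
  "colmajor_index m (Suc k) q = (q mod m) # colmajor_index m k (q div m)"
  unfolding colmajor_index_def
  by (subst upt_conv_Cons) (auto simp: map_Suc_upt[symmetric] div_mult2_eq simp del: upt_Suc)

lemma colmajor_index_image:
  assumes "m \<ge> 1"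
  shows "colmajor_index m k ` {..<m ^ k} = multi_indices m k"
proof (induction k)
  case 0
  then show ?case by (auto simp: colmajor_index_def multi_indices_def)
next
  case (Suc k)
  show ?case
  proof (intro equalityI subsetI)
    fix "is" assume "is \<in> colmajor_index m (Suc k) ` {..<m ^ Suc k}"
    then show "is \<in> multi_indices m (Suc k)"
      using assms by (auto simp: colmajor_index_def multi_indices_def)
  next
    fix "is" assume "is \<in> multi_indices m (Suc k)"
    then obtain i js where "is": "is = i # js" "i < m" "js \<in> multi_indices m k"
      by (cases "is") (auto simp: multi_indices_def)
    with Suc obtain q where q: "q < m ^ k" "js = colmajor_index m k q" by blast
    have "i + m * q < m * Suc q" using "is" by simp
    also have "\<dots> \<le> m ^ Suc k" using q(1) by (metis Suc_leI mult_le_mono2 power_Suc)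
    finally have "i + m * q < m ^ Suc k" .
    moreover have "colmajor_index m (Suc k) (i + m * q) = is"
      using "is" q by (simp add: colmajor_index_Suc)
    ultimately show "is \<in> colmajor_index m (Suc k) ` {..<m ^ Suc k}" by blast
  qed
qed

lemma set_col_indices:
  assumes "m \<ge> 1"
  shows "set (col_indices m d) = (SIGMA s:{1..d}. multi_indices m (s - 1))"
  unfolding colmajor_index_image[OF assms, symmetric]
  by (auto simp: col_indices_def)

lemma Psi_index:
  assumes "j < m" "k < Delta m d" "col_indices m d ! k = (s, is)"
  shows "Psi m d p $$ (j, k) = coeff_tensors m d p s (j # is)"
proof -
  let ?f = "\<lambda>(s, is). Matrix.vec m (\<lambda>i. coeff_tensors m d p s (i # is))"
  have cols: "cols (unfolding1 m s T)
      = map (\<lambda>q. Matrix.vec m (\<lambda>i. T (i # colmajor_index m (s - 1) q))) [0..<m ^ (s - 1)]" for s T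
    by (auto simp: cols_def unfolding1_def)
  have "Psi m d p = mat_of_cols m (map ?f (col_indices m d))"
    unfolding Psi_def cols col_indices_def map_concat map_map o_def by simp
  then show ?thesis
    using assms by (simp add: mat_of_cols_index length_col_indices)
qed

text \<open>The low base-\<open>m\<close> digits survive truncation; needed because an entry of a
  Kronecker product is addressed by quotient and remainder.\<close>

lemma mod_power_div_mod:
  fixes q m :: nat
  assumes "l < k" "m > 0"
  shows "q mod m ^ k div m ^ l mod m = q div m ^ l mod m"
proof -
  have "m ^ k = m ^ l * m ^ (k - l)" using assms by (simp flip: power_add)
  then have "q mod m ^ k div m ^ l = q div m ^ l mod m ^ (k - l)"
    using assms by (simp add: mod_mult2_eq)
  moreover have "m dvd m ^ (k - l)" using assms by (simp add: dvd_power)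
  ultimately show ?thesis by (simp add: mod_mod_cancel)
qed

text \<open>The recursion of \<open>kronecker_power\<close> adds the most significant digit, while
  column-major lists begin with the least significant one. The induction step therefore appends at
  the end of the list, and commutativity of the product reconciles the two orders.\<close>

lemma kronecker_power_index:
  assumes u: "u \<in> carrier_vec m"
  shows "dim_vec (kronecker_power u k) = m ^ k"
    and "q < m ^ k \<Longrightarrow>
      kronecker_power u k $ q = prod_list (map (\<lambda>i. u $ i) (colmajor_index m k q))"
proof -
  have dim: "dim_vec (kronecker_power u k) = m ^ k" for k
    using u by (induction k) (auto simp: kronecker_def)
  then show "dim_vec (kronecker_power u k) = m ^ k" .
  show "kronecker_power u k $ q = prod_list (map (\<lambda>i. u $ i) (colmajor_index m k q))"
    if "q < m ^ k" using that
  proof (induction k arbitrary: q)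
    case 0
    then show ?case by (simp add: colmajor_index_def)
  next
    case (Suc k)
    have m: "m > 0" using Suc.prems by (cases m) auto
    have lt: "q div m ^ k < m"
      using Suc.prems by (simp add: less_mult_imp_div_less mult.commute)
    have low: "colmajor_index m k (q mod m ^ k) = colmajor_index m k q"
      using m by (auto simp: colmajor_index_def mod_power_div_mod)
    have app: "colmajor_index m (Suc k) q = colmajor_index m k q @ [q div m ^ k]"
      using lt by (simp add: colmajor_index_def)
    have "kronecker_power u (Suc k) $ q = u $ (q div m ^ k) * kronecker_power u k $ (q mod m ^ k)"
      using Suc.prems u dim[of k] by (simp add: kronecker_def)
    also have "\<dots> = u $ (q div m ^ k) * prod_list (map (\<lambda>i. u $ i) (colmajor_index m k q))"
      using Suc.IH[of "q mod m ^ k"] m low by simp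
    finally show ?case by (simp add: app mult.commute)
  qed
qed

lemma vandermonde_col_index:
  assumes u: "u \<in> carrier_vec m"
  shows "dim_vec (vandermonde_col d u) = Delta m d"
    and "k < Delta m d \<Longrightarrow> col_indices m d ! k = (s, is) \<Longrightarrow>
      vandermonde_col d u $ k = real s * prod_list (map (\<lambda>i. u $ i) is)"
proof -
  let ?f = "\<lambda>(s, is). real s * prod_list (map (\<lambda>i. u $ i) is)"
  have block: "list_of_vec (real s \<cdot>\<^sub>v kronecker_power u (s - 1))
      = map (\<lambda>q. real s * prod_list (map (\<lambda>i. u $ i) (colmajor_index m (s - 1) q))) [0..<m ^ (s - 1)]"
    for s by (intro nth_equalityI) (auto simp: list_of_vec_index kronecker_power_index[OF u])
  have "vandermonde_col d u = vec_of_list (map ?f (col_indices m d))"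
    unfolding vandermonde_col_def block col_indices_def map_concat map_map o_def by simp
  then show "dim_vec (vandermonde_col d u) = Delta m d"
    and "k < Delta m d \<Longrightarrow> col_indices m d ! k = (s, is) \<Longrightarrow>
      vandermonde_col d u $ k = real s * prod_list (map (\<lambda>i. u $ i) is)"
    by (simp_all add: length_col_indices vec_of_list_index)
qed

section \<open>Injectivity of evaluation at the sampling points\<close>

lemma (in vec_space) weighted_sum_in_span:
  assumes B: "B \<subseteq> carrier_vec n" and "finite F" "\<And>x. x \<in> F \<Longrightarrow> b x \<in> B"
  shows "Matrix.vec n (\<lambda>k. \<Sum>x\<in>F. a x * b x $ k) \<in> span B"
  using assms(2,3)
proof (induction F)
  case empty
  have "Matrix.vec n (\<lambda>k. 0 :: 'a) = 0\<^sub>v n" by auto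
  moreover have "0\<^sub>v n \<in> span B"
    by (rule in_spanI[of _ "\<lambda>_. 0" "{}"]) (auto simp: lincomb_def)
  ultimately show ?case by simp
next
  case (insert x F)
  have bx: "b x \<in> B" using insert by simp
  then have dim: "dim_vec (b x) = n" using B by auto
  have "a x \<cdot>\<^sub>v b x \<in> span B"
    using smult_in_span[OF B] span_mem[OF B bx] by simp
  then have "a x \<cdot>\<^sub>v b x + Matrix.vec n (\<lambda>k. \<Sum>x\<in>F. a x * b x $ k) \<in> span B"
    using span_add1[OF _ _ insert.IH] B insert.prems by simp
  also have "a x \<cdot>\<^sub>v b x + Matrix.vec n (\<lambda>k. \<Sum>x\<in>F. a x * b x $ k)
      = Matrix.vec n (\<lambda>k. \<Sum>x\<in>insert x F. a x * b x $ k)"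
    using insert.hyps dim by (intro eq_vecI) auto
  finally show ?case .
qed

text \<open>If a polynomial \<open>\<Sum> c\<^sub>\<gamma> u\<^sup>\<gamma>\<close> with \<open>c\<^sub>\<alpha> \<noteq> 0\<close> vanishes at the sampling points, it expresses
  \<open>u\<^sup>\<alpha>\<close> there through the other monomials, so that the columns of the Vandermonde matrix lie in a
  space of dimension less than the number of monomials.\<close>

lemma evaluation_injective:
  assumes "m \<ge> 1" "d \<ge> 1" and U: "\<forall>l<N. U l \<in> carrier_vec m"
    and rank: "vec_space.rank (Delta m d) (vandermonde_mat m d N U) = (m + d - 1) choose (d - 1)"
    and q: "polydeg m (d - 1) q" "\<And>l. l < N \<Longrightarrow> q (U l) = 0" and u: "u \<in> carrier_vec m"
  shows "q u = 0"
proof (rule ccontr)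
  let ?E = "exponents_upto m (d - 1)"
  let ?n = "Delta m d"
  interpret V: vec_space "TYPE(real)" ?n .
  assume "q u \<noteq> 0"
  obtain c where c: "\<And>u. u \<in> carrier_vec m \<Longrightarrow> q u = (\<Sum>\<alpha>\<in>?E. c \<alpha> * monomial m \<alpha> u)"
    using q unfolding polydeg_def by blast
  have "\<exists>\<alpha>\<in>?E. c \<alpha> \<noteq> 0"
  proof (rule ccontr)
    assume "\<not> ?thesis"
    then show False using c[OF u] \<open>q u \<noteq> 0\<close> by simp
  qed
  then obtain \<alpha> where \<alpha>: "\<alpha> \<in> ?E" "c \<alpha> \<noteq> 0" by blast
  \<comment> \<open>The Vandermonde column at a point is the sum over \<gamma> of the value of the
    monomial \<gamma> times the vector \<open>\<epsilon> \<gamma>\<close>; the entry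
    \<open>s\<close> is the weight of the block.\<close>
  define \<epsilon> where "\<epsilon> = (\<lambda>\<gamma> k. case col_indices m d ! k of
      (s, is) \<Rightarrow> if count_list is = \<gamma> then real s else 0)"
  \<comment> \<open>Eliminating the monomial \<alpha> by its relation to the others, with factors
    \<open>- c \<gamma> / c \<alpha>\<close>, turns the coefficient vector of the monomial \<gamma>
    from \<open>\<epsilon> \<gamma>\<close> into \<open>b \<gamma>\<close>.\<close>
  define b where "b = (\<lambda>\<gamma>. Matrix.vec ?n (\<lambda>k. \<epsilon> \<gamma> k - c \<gamma> / c \<alpha> * \<epsilon> \<alpha> k))"
  define B where "B = b ` (?E - {\<alpha>})"
  have B: "finite B" "B \<subseteq> carrier_vec ?n" by (auto simp: B_def b_def)
  have col: "vandermonde_col d (U l) \<in> V.span B" if l: "l < N" for l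
  proof -
    let ?mon = "\<lambda>\<gamma>. monomial m \<gamma> (U l)"
    have Ul: "U l \<in> carrier_vec m" using U l by simp
    have rel: "(\<Sum>\<gamma>\<in>?E - {\<alpha>}. c \<gamma> * ?mon \<gamma>) = - c \<alpha> * ?mon \<alpha>"
      using c[OF Ul] q(2)[OF l] sum.remove[OF finite_exponents_upto \<alpha>(1), of "\<lambda>\<gamma>. c \<gamma> * ?mon \<gamma>"]
      by simp
    have "vandermonde_col d (U l) = Matrix.vec ?n (\<lambda>k. \<Sum>\<gamma>\<in>?E - {\<alpha>}. ?mon \<gamma> * b \<gamma> $ k)"
    proof (rule eq_vecI)
      fix k assume "k < dim_vec (Matrix.vec ?n (\<lambda>k. \<Sum>\<gamma>\<in>?E - {\<alpha>}. ?mon \<gamma> * b \<gamma> $ k))"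
      then have k: "k < ?n" by simp
      obtain s "is" where si: "col_indices m d ! k = (s, is)" by fastforce
      have "(s, is) \<in> (SIGMA s:{1..d}. multi_indices m (s - 1))"
        using nth_mem[of k "col_indices m d"] k si set_col_indices[OF \<open>m \<ge> 1\<close>]
        by (simp add: length_col_indices)
      then have mi: "is \<in> multi_indices m (s - 1)" "s \<le> d" by auto
      then have E: "count_list is \<in> ?E" by (auto simp: exponents_upto_def count_list_multi_index)
      have "vandermonde_col d (U l) $ k = real s * ?mon (count_list is)"
        using vandermonde_col_index(2)[OF Ul k si] mi prod_list_eq_monomial
        by (simp add: multi_indices_def)
      also have "\<dots> = (\<Sum>\<gamma>\<in>?E. ?mon \<gamma> * \<epsilon> \<gamma> k)"
        using E by (simp add: \<epsilon>_def si if_distrib cong: if_cong)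
      also have "\<dots> = ?mon \<alpha> * \<epsilon> \<alpha> k + (\<Sum>\<gamma>\<in>?E - {\<alpha>}. ?mon \<gamma> * \<epsilon> \<gamma> k)"
        using \<alpha> by (intro sum.remove) auto
      also have "?mon \<alpha> = - (\<Sum>\<gamma>\<in>?E - {\<alpha>}. c \<gamma> * ?mon \<gamma>) / c \<alpha>"
        using rel \<alpha>(2) by (simp add: field_simps)
      also have "- (\<Sum>\<gamma>\<in>?E - {\<alpha>}. c \<gamma> * ?mon \<gamma>) / c \<alpha> * \<epsilon> \<alpha> k + (\<Sum>\<gamma>\<in>?E - {\<alpha>}. ?mon \<gamma> * \<epsilon> \<gamma> k)
          = (\<Sum>\<gamma>\<in>?E - {\<alpha>}. ?mon \<gamma> * b \<gamma> $ k)"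
        using k unfolding b_def
        by (simp add: sum_distrib_left sum_distrib_right sum_divide_distrib right_diff_distrib sum_subtractf mult_ac)
      finally show "vandermonde_col d (U l) $ k
          = Matrix.vec ?n (\<lambda>k. \<Sum>\<gamma>\<in>?E - {\<alpha>}. ?mon \<gamma> * b \<gamma> $ k) $ k"
        using k by simp
    qed (simp add: vandermonde_col_index(1)[OF Ul])
    then show ?thesis
      using V.weighted_sum_in_span[OF B(2), of "?E - {\<alpha>}" b ?mon] by (simp add: B_def)
  qed
  have "vandermonde_mat m d N U \<in> carrier_mat ?n N"
    unfolding vandermonde_mat_def by (intro carrier_matI) simp_all
  moreover have "set (cols (vandermonde_mat m d N U)) \<subseteq> V.span B"
  proof -
    have "vandermonde_col d (U l) \<in> carrier_vec ?n" if "l < N" for l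
      by (rule carrier_vecI[OF vandermonde_col_index(1)[OF U[rule_format, OF that]]])
    then have "set (map (\<lambda>l. vandermonde_col d (U l)) [0..<N]) \<subseteq> carrier_vec ?n"
      by (simp add: image_subset_iff)
    from cols_mat_of_cols[OF this]
    have "set (cols (vandermonde_mat m d N U)) = (\<lambda>l. vandermonde_col d (U l)) ` {0..<N}"
      unfolding vandermonde_mat_def by simp
    then show ?thesis using col by (simp add: image_subset_iff)
  qed
  ultimately have "V.rank (vandermonde_mat m d N U) \<le> card B"
    by (rule V.rank_le_card_spanning[OF _ B])
  then have "(m + d - 1) choose (d - 1) \<le> card B" unfolding rank .
  also have "\<dots> \<le> card (?E - {\<alpha>})" unfolding B_def by (rule card_image_le) simp
  also have "\<dots> < card ?E" using \<alpha> by (intro psubset_card_mono) auto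
  also have "\<dots> = (m + d - 1) choose (d - 1)"
    using \<open>d \<ge> 1\<close> by (simp add: card_exponents_upto)
  finally show False by simp
qed

lemma polynomial_fun_coeff_family:
  assumes "coeff_family m d p \<Psi>"
  shows "polynomial_fun m d p"
proof -
  let ?X = "multi_indices_upto m d"
  have "p u = (\<Sum>\<gamma>\<in>exponents m d. (\<Sum>x\<in>{x\<in>?X. count_list (snd x) = \<gamma>}. \<Psi> (fst x) (snd x)) *
      monomial m \<gamma> u)" if "u \<in> carrier_vec m" for u
    using assms that unfolding coeff_family_def sum_multi_indices_monomial
    by (subst sum_monomials_fibre[OF finite_multi_indices_upto finite_exponents
            equalityD1[OF count_list_multi_indices_upto], symmetric]) auto
  then show ?thesis unfolding polynomial_fun_def monomial_def
    by (intro exI[of _ "\<lambda>\<gamma>. \<Sum>x\<in>{x\<in>?X. count_list (snd x) = \<gamma>}. \<Psi> (fst x) (snd x)"]) blast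
qed

section \<open>Powers of linear forms as symmetric tensors\<close>

lemma power_sum_multi_indices:
  fixes x :: "nat \<Rightarrow> 'a :: comm_semiring_1"
  shows "(\<Sum>i<m. x i) ^ s = (\<Sum>is\<in>multi_indices m s. prod_list (map x is))"
proof (induction s)
  case 0
  have "multi_indices m 0 = {[]}" by (auto simp: multi_indices_def)
  then show ?case by simp
next
  case (Suc s)
  have "bij_betw (\<lambda>(i, is). i # is) ({..<m} \<times> multi_indices m s) (multi_indices m (Suc s))"
    by (rule bij_betw_byWitness[where f' = "\<lambda>is. (hd is, tl is)"])
      (auto simp: multi_indices_def length_Suc_conv)
  then have "(\<Sum>is\<in>multi_indices m (Suc s). prod_list (map x is))
      = (\<Sum>y\<in>{..<m} \<times> multi_indices m s. prod_list (map x (case y of (i, is) \<Rightarrow> i # is)))"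
    by (rule sum.reindex_bij_betw[symmetric])
  also have "\<dots> = (\<Sum>i<m. x i) * (\<Sum>is\<in>multi_indices m s. prod_list (map x is))"
    unfolding sum_product sum.cartesian_product by (intro sum.cong) auto
  finally show ?case using Suc by simp
qed

lemma prod_list_map_mult:
  fixes x y :: "'b \<Rightarrow> 'a :: comm_monoid_mult"
  shows "prod_list (map (\<lambda>i. x i * y i) is) = prod_list (map x is) * prod_list (map y is)"
  by (induction "is") (auto simp: mult_ac)

text \<open>Expanding without collecting equal monomials leaves no multinomial coefficients: the
  symmetric tensor of the power is exactly v \<otimes> ... \<otimes> v.\<close>

lemma scalar_prod_power:
  fixes v u :: "real vec"
  assumes "v \<in> carrier_vec m" "u \<in> carrier_vec m"
  shows "(v \<bullet> u) ^ s = (\<Sum>is\<in>multi_indices m s.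
      prod_list (map (\<lambda>i. v $ i) is) * prod_list (map (\<lambda>i. u $ i) is))"
proof -
  have "v \<bullet> u = (\<Sum>i<m. v $ i * u $ i)"
    using assms by (simp add: scalar_prod_def atLeast0LessThan)
  then show ?thesis by (simp add: power_sum_multi_indices prod_list_map_mult)
qed

lemma poly_eq_sum_powers:
  fixes g :: "real poly"
  assumes "degree g \<le> d" "coeff g 0 = 0"
  shows "poly g t = (\<Sum>s=1..d. coeff g s * t ^ s)"
proof -
  have "poly g t = (\<Sum>s\<le>d. coeff g s * t ^ s)"
    unfolding poly_altdef using assms(1)
    by (intro sum.mono_neutral_left) (auto simp: coeff_eq_0)
  also have "\<dots> = (\<Sum>s=1..d. coeff g s * t ^ s)"
    using assms(2) by (intro sum.mono_neutral_right) (auto simp: not_less_eq_eq)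
  finally show ?thesis .
qed

section \<open>Ridge maps and the tensor of unfoldings\<close>

abbreviation (input) ridge_data :: "nat \<Rightarrow> nat \<Rightarrow> nat \<Rightarrow> real vec \<Rightarrow> real vec \<Rightarrow> real poly \<Rightarrow> bool" where
  "ridge_data n m d w v g \<equiv>
     w \<in> carrier_vec n \<and> v \<in> carrier_vec m \<and> degree g \<le> d \<and> coeff g 0 = 0"

text \<open>The data may be zero, so the zero map is included; nonvanishing, which CP rank 1
  requires, is arranged separately in \<open>nonzero_ridge_terms\<close>.\<close>

definition ridge_map ::
  "nat \<Rightarrow> nat \<Rightarrow> nat \<Rightarrow> real vec \<Rightarrow> real vec \<Rightarrow> real poly \<Rightarrow> (real vec \<Rightarrow> real vec) \<Rightarrow> bool" where
  "ridge_map n m d w v g p \<longleftrightarrow>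
     ridge_data n m d w v g \<and>
     (\<forall>u\<in>carrier_vec m. p u \<in> carrier_vec n) \<and>
     (\<forall>u\<in>carrier_vec m. \<forall>i<n. p u $ i = w $ i * poly g (v \<bullet> u))"

text \<open>Each power of the linear form contributes a multiple of v \<otimes> ... \<otimes> v,
  which is symmetric because multiplication commutes.\<close>

lemma coeff_family_ridge:
  assumes "v \<in> carrier_vec m" "degree g \<le> d" "coeff g 0 = 0"
    and p: "\<And>u. u \<in> carrier_vec m \<Longrightarrow> p u = a * poly g (v \<bullet> u)"
  shows "coeff_family m d p (\<lambda>s is. if s \<in> {1..d} \<and> is \<in> multi_indices m s
    then a * coeff g s * prod_list (map (\<lambda>i. v $ i) is) else 0)" (is "coeff_family m d p ?\<Psi>")
  unfolding coeff_family_def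
proof (intro conjI ballI allI impI)
  fix s assume "s \<in> {1..d}"
  show "?\<Psi> s \<in> symmetric_tensors m s"
    unfolding symmetric_tensors_def
  proof (intro CollectI conjI allI impI ballI)
    fix "is" \<pi> assume "is \<in> multi_indices m s" "\<pi> permutes {..<s}"
    then have "mset (permute_list \<pi> is) = mset is"
      by (intro mset_permute_list) (simp add: multi_indices_def)
    then have "prod_list (map (\<lambda>i. v $ i) (permute_list \<pi> is)) = prod_list (map (\<lambda>i. v $ i) is)"
      and "set (permute_list \<pi> is) = set is"
      using mset_eq_setD by (simp_all flip: prod_mset_prod_list)
    then show "?\<Psi> s (permute_list \<pi> is) = ?\<Psi> s is" by (simp add: multi_indices_def)
  qed simp
next
  fix u :: "real vec" assume u: "u \<in> carrier_vec m"
  have "p u = (\<Sum>s=1..d. a * coeff g s * (v \<bullet> u) ^ s)"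
    using p[OF u] poly_eq_sum_powers[OF assms(2,3)] by (simp add: sum_distrib_left mult.assoc)
  also have "\<dots> = (\<Sum>s=1..d. \<Sum>is\<in>multi_indices m s. ?\<Psi> s is * prod_list (map (\<lambda>i. u $ i) is))"
    unfolding scalar_prod_power[OF assms(1) u] sum_distrib_left
    by (intro sum.cong refl) (auto simp: mult.assoc)
  finally show "p u = (\<Sum>s=1..d. \<Sum>is\<in>multi_indices m s. ?\<Psi> s is * prod_list (map (\<lambda>i. u $ i) is))" .
qed auto

lemma ridge_map_polynomial:
  assumes "ridge_map n m d w v g p"
  shows "p \<in> polynomial_maps n m d"
proof -
  have "polynomial_fun m d (\<lambda>u. p u $ i)" if "i < n" for i
    by (rule polynomial_fun_coeff_family, rule coeff_family_ridge[of v m g d _ "w $ i"])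
      (use assms that in \<open>auto simp: ridge_map_def\<close>)
  then show ?thesis using assms by (simp add: ridge_map_def polynomial_maps_def)
qed

lemma Q_tensor_index:
  assumes "i < n" "j < m" "k < Delta m d" "col_indices m d ! k = (s, is)"
  shows "Q_tensor n m d p i j k = coeff_tensors m d (\<lambda>u. p u $ i) s (j # is)"
  using assms Psi_index by (simp add: Q_tensor_def tensor3_def)

lemma col_index_exists:
  assumes "m \<ge> 1" "s \<in> {1..d}" "is \<in> multi_indices m (s - 1)"
  shows "\<exists>k<Delta m d. col_indices m d ! k = (s, is)"
proof -
  have "(s, is) \<in> set (col_indices m d)" using assms by (simp add: set_col_indices)
  then show ?thesis unfolding in_set_conv_nth length_col_indices .
qed

lemma Cons_multi_indices_iff:
  assumes "s \<ge> 1"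
  shows "j # is \<in> multi_indices m s \<longleftrightarrow> j < m \<and> is \<in> multi_indices m (s - 1)"
  using assms by (auto simp: multi_indices_def)

text \<open>Every coefficient occurs in the tensor, as a nonempty multi-index splits into a row
  \<open>j\<close> and a column label; so a tensor identity can be read entrywise and reassembled
  into polynomials. Conversely, the sum of the coefficient families represents \<open>f\<close>, and
  uniqueness identifies it with the family of \<open>f\<close>.\<close>

lemma Q_tensor_sum_iff:
  assumes "m \<ge> 1" and f: "f \<in> polynomial_maps n m d"
    and p: "\<And>k. k < r \<Longrightarrow> p k \<in> polynomial_maps n m d"
  shows "Q_tensor n m d f = tensor_sum r (\<lambda>k. Q_tensor n m d (p k)) \<longleftrightarrow>
    (\<forall>u\<in>carrier_vec m. \<forall>i<n. f u $ i = (\<Sum>k<r. p k u $ i))" (is "?L \<longleftrightarrow> ?R")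
proof
  let ?T = "\<lambda>(h :: real vec \<Rightarrow> real vec) i. coeff_tensors m d (\<lambda>u. h u $ i)"
  have fam: "coeff_family m d (\<lambda>u. h u $ i) (?T h i)"
    if "h \<in> polynomial_maps n m d" "i < n" for h i
    using that coeff_family_coeff_tensors by (auto simp: polynomial_maps_def)
  note famD = fam[unfolded coeff_family_def]
  show ?R if ?L
  proof (intro ballI allI impI)
    fix u :: "real vec" and i assume u: "u \<in> carrier_vec m" and i: "i < n"
    have T: "?T f i s is = (\<Sum>k<r. ?T (p k) i s is)" if s: "s \<in> {1..d}" "is \<in> multi_indices m s" for s "is"
    proof -
      obtain j js where "is": "is = j # js" using s by (cases "is") (auto simp: multi_indices_def)
      with s have j: "j < m" "js \<in> multi_indices m (s - 1)" using Cons_multi_indices_iff[of s] by auto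
      then obtain k where k: "k < Delta m d" "col_indices m d ! k = (s, js)"
        using col_index_exists[OF \<open>m \<ge> 1\<close>] s by blast
      from fun_cong[OF fun_cong[OF fun_cong[OF \<open>?L\<close>]], of i j k] show ?thesis
        by (simp add: tensor_sum_def Q_tensor_index[OF i j(1) k] "is")
    qed
    have "f u $ i = (\<Sum>s=1..d. \<Sum>is\<in>multi_indices m s.
        (\<Sum>k<r. ?T (p k) i s is) * prod_list (map (\<lambda>i. u $ i) is))"
      using famD[OF f i] u T by simp
    also have "\<dots> = (\<Sum>k<r. \<Sum>s=1..d. \<Sum>is\<in>multi_indices m s.
        ?T (p k) i s is * prod_list (map (\<lambda>i. u $ i) is))"
      unfolding sum_distrib_right by (subst sum.swap) (intro sum.cong refl sum.swap)
    also have "\<dots> = (\<Sum>k<r. p k u $ i)"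
      using famD[OF p i] u by (intro sum.cong) auto
    finally show "f u $ i = (\<Sum>k<r. p k u $ i)" .
  qed
  show ?L if ?R
  proof (intro ext)
    fix i j k
    show "Q_tensor n m d f i j k = tensor_sum r (\<lambda>k. Q_tensor n m d (p k)) i j k"
    proof (cases "i < n \<and> j < m \<and> k < Delta m d")
      case False
      then show ?thesis by (auto simp: Q_tensor_def tensor3_def tensor_sum_def)
    next
      case True
      then have i: "i < n" by simp
      have "coeff_family m d (\<lambda>u. f u $ i) (\<lambda>s is. \<Sum>q<r. ?T (p q) i s is)"
        unfolding coeff_family_def
      proof (intro conjI ballI allI impI)
        fix s assume s: "s \<in> {1..d}"
        then have "?T (p q) i s \<in> symmetric_tensors m s" if "q < r" for q
          using famD[OF p i] that by blast
        then show "(\<lambda>is. \<Sum>q<r. ?T (p q) i s is) \<in> symmetric_tensors m s"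
          by (auto simp: symmetric_tensors_def)
      next
        fix s assume s: "s \<notin> {1..d}"
        then have "?T (p q) i s = (\<lambda>is. 0)" if "q < r" for q
          using famD[OF p i] that by blast
        then show "(\<lambda>is. \<Sum>q<r. ?T (p q) i s is) = (\<lambda>is. 0)" by auto
      next
        fix u :: "real vec" assume u: "u \<in> carrier_vec m"
        have "f u $ i = (\<Sum>q<r. p q u $ i)" using \<open>?R\<close> u i by blast
        also have "\<dots> = (\<Sum>q<r. \<Sum>s=1..d. \<Sum>is\<in>multi_indices m s.
            ?T (p q) i s is * prod_list (map (\<lambda>i. u $ i) is))"
          using famD[OF p i] u by (intro sum.cong) auto
        also have "\<dots> = (\<Sum>s=1..d. \<Sum>is\<in>multi_indices m s.
            (\<Sum>q<r. ?T (p q) i s is) * prod_list (map (\<lambda>i. u $ i) is))"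
          unfolding sum_distrib_right by (subst sum.swap) (intro sum.cong refl sum.swap)
        finally show "f u $ i = (\<Sum>s=1..d. \<Sum>is\<in>multi_indices m s.
            (\<Sum>q<r. ?T (p q) i s is) * prod_list (map (\<lambda>i. u $ i) is))" .
      qed
      then have "?T f i = (\<lambda>s is. \<Sum>q<r. ?T (p q) i s is)" by (rule coeff_tensors_eqI)
      moreover obtain s "is" where "col_indices m d ! k = (s, is)" by fastforce
      ultimately show ?thesis using True by (simp add: tensor_sum_def Q_tensor_index)
    qed
  qed
qed

text \<open>In the entry for \<open>j # is\<close> the factor \<open>v $ j\<close> splits off. What
  remains besides \<open>w $ i\<close> depends on the column label alone and forms the third
  vector.\<close>

lemma ridge_map_Q_tensor_outer3:
  assumes "m \<ge> 1" and ridge: "ridge_map n m d w v g p"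
  shows "\<exists>a b c. a \<in> carrier_vec n \<and> b \<in> carrier_vec m \<and> c \<in> carrier_vec (Delta m d) \<and>
    Q_tensor n m d p = outer3 a b c"
proof -
  define c where "c = Matrix.vec (Delta m d) (\<lambda>k. case col_indices m d ! k of
      (s, is) \<Rightarrow> coeff g s * prod_list (map (\<lambda>i. v $ i) is))"
  have wv: "w \<in> carrier_vec n" "v \<in> carrier_vec m" using ridge by (auto simp: ridge_map_def)
  have "Q_tensor n m d p i j k = w $ i * v $ j * c $ k"
    if ijk: "i < n" "j < m" "k < Delta m d" for i j k
  proof -
    obtain s "is" where si: "col_indices m d ! k = (s, is)" by fastforce
    have "(s, is) \<in> (SIGMA s:{1..d}. multi_indices m (s - 1))"
      using nth_mem[of k "col_indices m d"] ijk si set_col_indices[OF \<open>m \<ge> 1\<close>]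
      by (simp add: length_col_indices)
    then have s: "s \<in> {1..d}" "j # is \<in> multi_indices m s"
      using ijk Cons_multi_indices_iff[of s j "is" m] by auto
    have "coeff_tensors m d (\<lambda>u. p u $ i) = (\<lambda>s is. if s \<in> {1..d} \<and> is \<in> multi_indices m s
        then w $ i * coeff g s * prod_list (map (\<lambda>i. v $ i) is) else 0)"
      using ridge ijk by (intro coeff_tensors_eqI coeff_family_ridge) (auto simp: ridge_map_def)
    with s show ?thesis
      using ijk by (simp add: Q_tensor_index[OF ijk si] c_def si)
  qed
  then have "Q_tensor n m d p = outer3 w v c"
    using wv unfolding outer3_def by (intro ext) (auto simp: Q_tensor_def tensor3_def c_def)
  then show ?thesis using wv by (intro exI[of _ w] exI[of _ v] exI[of _ c]) (auto simp: c_def)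
qed

text \<open>By symmetry the factorisation can be applied to every index in turn.\<close>

lemma symmetric_tensor_rank_one:
  assumes T: "T \<in> symmetric_tensors m s"
    and fac: "\<And>j is. j < m \<Longrightarrow> is \<in> multi_indices m (s - 1) \<Longrightarrow> T (j # is) = b j * C is"
    and j: "j < m" and "is": "is \<in> multi_indices m s"
  shows "T is * b j ^ s = T (replicate s j) * prod_list (map b is)"
proof -
  \<comment> \<open>Here \<open>k\<close> letters have already been replaced by \<open>j\<close> and
    \<open>js\<close> is still to be treated. Stating the claim without division keeps it valid for
    \<open>b j = 0\<close>.\<close>
  have "T (replicate k j @ js) * b j ^ length js = T (replicate s j) * prod_list (map b js)"
    if "set js \<subseteq> {..<m}" "k + length js = s" for k js
    using that
  proof (induction js arbitrary: k)
    case (Cons i js)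
    let ?r = "replicate k j @ js"
    have r: "?r \<in> multi_indices m (s - 1)" and i: "i < m"
      using Cons.prems j by (auto simp: multi_indices_def)
    have "T (replicate k j @ i # js) = T (i # ?r)"
      using T Cons.prems i r by (intro symmetric_tensor_mset_cong[OF T]) (auto simp: multi_indices_def)
    \<comment> \<open>Both \<open>i # ?r\<close> and \<open>j # ?r\<close> factor through the same
      \<open>C ?r\<close>, so exchanging the first letter exchanges \<open>b i\<close> for
      \<open>b j\<close>.\<close>
    also have "\<dots> * b j = b i * T (replicate (Suc k) j @ js)"
      using fac[OF i r] fac[OF j r] by simp
    finally have "T (replicate k j @ i # js) * b j ^ length (i # js)
        = b i * (T (replicate (Suc k) j @ js) * b j ^ length js)"
      by (simp add: mult.assoc)
    also have "\<dots> = T (replicate s j) * prod_list (map b (i # js))"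
      using Cons.IH[of "Suc k"] Cons.prems by simp
    finally show ?case .
  qed auto
  from this[of "is" 0] "is" show ?thesis by (auto simp: multi_indices_def)
qed

lemma Q_tensor_outer3_imp_ridge:
  assumes "m \<ge> 1" and p: "p \<in> polynomial_maps n m d"
    and abc: "a \<in> carrier_vec n" "b \<in> carrier_vec m" "c \<in> carrier_vec (Delta m d)"
    and Q: "Q_tensor n m d p = outer3 a b c"
  shows "\<exists>w v g. ridge_map n m d w v g p"
proof -
  let ?T = "\<lambda>i. coeff_tensors m d (\<lambda>u. p u $ i)"
  have fam: "coeff_family m d (\<lambda>u. p u $ i) (?T i)" if "i < n" for i
    using p that coeff_family_coeff_tensors by (auto simp: polynomial_maps_def)
  note famD = fam[unfolded coeff_family_def]
  \<comment> \<open>The vector \<open>c\<close>, read by label instead of by column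
    position.\<close>
  define C where "C = (\<lambda>s is. c $ (SOME k. k < Delta m d \<and> col_indices m d ! k = (s, is)))"
  have fac: "?T i s (j # is) = b $ j * (a $ i * C s is)"
    if ij: "i < n" "j < m" and si: "s \<in> {1..d}" "is \<in> multi_indices m (s - 1)" for i j s "is"
  proof -
    define k where "k = (SOME k. k < Delta m d \<and> col_indices m d ! k = (s, is))"
    have k: "k < Delta m d" "col_indices m d ! k = (s, is)"
      using someI_ex[OF col_index_exists[OF \<open>m \<ge> 1\<close> si]] unfolding k_def by auto
    from fun_cong[OF fun_cong[OF fun_cong[OF Q]], of i j k] show ?thesis
      using abc ij k by (simp add: Q_tensor_index outer3_def tensor3_def C_def k_def[symmetric])
  qed
  have pn: "p u \<in> carrier_vec n" if "u \<in> carrier_vec m" for u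
    using p that by (auto simp: polynomial_maps_def)
  show ?thesis
  proof (cases "\<exists>j<m. b $ j \<noteq> 0")
    \<comment> \<open>With \<open>b\<close> zero all coefficient tensors vanish, so \<open>p\<close>
      is the zero map.\<close>
    case False
    have "p u $ i = 0" if "u \<in> carrier_vec m" "i < n" for u i
    proof -
      have "?T i s is = 0" if s: "s \<in> {1..d}" "is \<in> multi_indices m s" for s "is"
      proof -
        obtain j js where "is": "is = j # js" using s by (cases "is") (auto simp: multi_indices_def)
        with s have "j < m" "js \<in> multi_indices m (s - 1)" using Cons_multi_indices_iff[of s] by auto
        then show ?thesis using fac \<open>i < n\<close> s False "is" by simp
      qed
      then show ?thesis using famD[OF \<open>i < n\<close>] \<open>u \<in> carrier_vec m\<close> by simp
    qed
    then have "ridge_map n m d (0\<^sub>v n) (0\<^sub>v m) 0 p" using pn by (simp add: ridge_map_def)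
    then show ?thesis by blast
  next
    case True
    then obtain j where j: "j < m" "b $ j \<noteq> 0" by blast
    \<comment> \<open>The rank-one formula divides the entry at \<open>replicate s j\<close> by
      \<open>b $ j ^ s\<close>; by the factorisation that entry is
      \<open>b $ j * (a $ i * C s (replicate (s - 1) j))\<close>. Apart from \<open>a $ i\<close>
      the quotient does not depend on \<open>i\<close>, so one \<open>g\<close> serves all
      components.\<close>
    define \<gamma> where "\<gamma> = (\<lambda>s. b $ j * C s (replicate (s - 1) j) / b $ j ^ s)"
    define g where "g = (\<Sum>s=1..d. monom (\<gamma> s) s)"
    have coeff_g: "coeff g s = (if s \<in> {1..d} then \<gamma> s else 0)" for s
      by (simp add: g_def coeff_sum)
    have g: "degree g \<le> d" "coeff g 0 = 0" by (auto simp: coeff_g intro: degree_le)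
    have T: "?T i s is = a $ i * \<gamma> s * prod_list (map (\<lambda>i. b $ i) is)"
      if i: "i < n" and s: "s \<in> {1..d}" "is \<in> multi_indices m s" for i s "is"
    proof -
      have "?T i s \<in> symmetric_tensors m s" using famD[OF i] s by blast
      from symmetric_tensor_rank_one[OF this fac[OF i] j(1) s(2)] s(1)
      have "?T i s is * b $ j ^ s = ?T i s (replicate s j) * prod_list (map (\<lambda>i. b $ i) is)" by blast
      moreover have "replicate s j = j # replicate (s - 1) j" using s(1) by (cases s) auto
      moreover have "replicate (s - 1) j \<in> multi_indices m (s - 1)"
        using j by (auto simp: multi_indices_def)
      ultimately have "?T i s is * b $ j ^ s
          = b $ j * (a $ i * C s (replicate (s - 1) j)) * prod_list (map (\<lambda>i. b $ i) is)"
        using fac[OF i j(1) s(1)] by metis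
      then show ?thesis using j(2) by (simp add: \<gamma>_def field_simps)
    qed
    have "p u $ i = a $ i * poly g (b \<bullet> u)" if u: "u \<in> carrier_vec m" and i: "i < n" for u i
    proof -
      have "p u $ i = (\<Sum>s=1..d. \<Sum>is\<in>multi_indices m s.
          a $ i * \<gamma> s * prod_list (map (\<lambda>i. b $ i) is) * prod_list (map (\<lambda>i. u $ i) is))"
        using famD[OF i] u T[OF i] by simp
      also have "\<dots> = (\<Sum>s=1..d. a $ i * (\<gamma> s * (b \<bullet> u) ^ s))"
        unfolding scalar_prod_power[OF abc(2) u] by (simp add: sum_distrib_left mult.assoc)
      also have "\<dots> = a $ i * poly g (b \<bullet> u)"
        unfolding poly_eq_sum_powers[OF g] by (simp add: coeff_g sum_distrib_left)
      finally show ?thesis .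
    qed
    then have "ridge_map n m d a b g p" using abc g pn by (simp add: ridge_map_def)
    then show ?thesis by blast
  qed
qed

section \<open>Ridge maps and the tensor of Jacobians\<close>

lemma monomial_has_derivative:
  assumes u: "u \<in> carrier_vec m" and x: "x \<in> carrier_vec m"
  shows "((\<lambda>t. monomial m \<alpha> (u + t \<cdot>\<^sub>v x)) has_real_derivative
    (\<Sum>j<m. x $ j * (real (\<alpha> j) * monomial m (\<alpha>(j := \<alpha> j - 1)) (u + t \<cdot>\<^sub>v x)))) (at t)"
proof -
  let ?y = "u + t \<cdot>\<^sub>v x"
  have "((\<lambda>t. \<Prod>i<m. (u $ i + t * x $ i) ^ \<alpha> i) has_real_derivative
      (\<Sum>j<m. real (\<alpha> j) * (u $ j + t * x $ j) ^ (\<alpha> j - 1) * x $ j *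
        (\<Prod>i\<in>{..<m} - {j}. (u $ i + t * x $ i) ^ \<alpha> i))) (at t)"
    by (rule has_field_derivative_prod) (auto intro!: derivative_eq_intros)
  moreover have "(\<Sum>j<m. real (\<alpha> j) * (u $ j + t * x $ j) ^ (\<alpha> j - 1) * x $ j *
        (\<Prod>i\<in>{..<m} - {j}. (u $ i + t * x $ i) ^ \<alpha> i))
      = (\<Sum>j<m. x $ j * (real (\<alpha> j) * monomial m (\<alpha>(j := \<alpha> j - 1)) ?y))"
  proof (intro sum.cong refl)
    fix j assume "j \<in> {..<m}"
    then have j: "j < m" by simp
    have "monomial m (\<alpha>(j := \<alpha> j - 1)) ?y
        = ?y $ j ^ (\<alpha> j - 1) * (\<Prod>i\<in>{..<m} - {j}. ?y $ i ^ \<alpha> i)"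
      unfolding monomial_def using j by (subst prod.remove[of _ j]) auto
    moreover have "(\<Prod>i\<in>{..<m} - {j}. ?y $ i ^ \<alpha> i)
        = (\<Prod>i\<in>{..<m} - {j}. (u $ i + t * x $ i) ^ \<alpha> i)"
      using u x by (intro prod.cong) auto
    ultimately show "real (\<alpha> j) * (u $ j + t * x $ j) ^ (\<alpha> j - 1) * x $ j *
        (\<Prod>i\<in>{..<m} - {j}. (u $ i + t * x $ i) ^ \<alpha> i)
      = x $ j * (real (\<alpha> j) * monomial m (\<alpha>(j := \<alpha> j - 1)) ?y)"
      using u x j by simp
  qed
  moreover have "monomial m \<alpha> (u + t \<cdot>\<^sub>v x) = (\<Prod>i<m. (u $ i + t * x $ i) ^ \<alpha> i)" for t
    unfolding monomial_def using u x by (intro prod.cong) auto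
  ultimately show ?thesis by simp
qed

text \<open>The formal partial derivative. Where \<open>\<alpha> j = 0\<close> the truncated
  exponent is harmless because of the factor \<open>real (\<alpha> j)\<close>.\<close>

definition diff_poly :: "nat \<Rightarrow> nat \<Rightarrow> ((nat \<Rightarrow> nat) \<Rightarrow> real) \<Rightarrow> nat \<Rightarrow> real vec \<Rightarrow> real" where
  "diff_poly m d c j u =
     (\<Sum>\<alpha>\<in>exponents m d. c \<alpha> * real (\<alpha> j) * monomial m (\<alpha>(j := \<alpha> j - 1)) u)"

lemma polynomial_funE:
  assumes "polynomial_fun m d p"
  obtains c where "\<And>u. u \<in> carrier_vec m \<Longrightarrow> p u = (\<Sum>\<alpha>\<in>exponents m d. c \<alpha> * monomial m \<alpha> u)"
  using assms unfolding polynomial_fun_def monomial_def by blast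

lemma polynomial_fun_has_derivative_aux:
  assumes p: "\<And>u. u \<in> carrier_vec m \<Longrightarrow> p u = (\<Sum>\<alpha>\<in>exponents m d. c \<alpha> * monomial m \<alpha> u)"
    and u: "u \<in> carrier_vec m" and x: "x \<in> carrier_vec m"
  shows "((\<lambda>t. p (u + t \<cdot>\<^sub>v x)) has_real_derivative
    (\<Sum>j<m. x $ j * diff_poly m d c j (u + t \<cdot>\<^sub>v x))) (at t)"
proof -
  have "((\<lambda>t. \<Sum>\<alpha>\<in>exponents m d. c \<alpha> * monomial m \<alpha> (u + t \<cdot>\<^sub>v x)) has_real_derivative
      (\<Sum>\<alpha>\<in>exponents m d. c \<alpha> * (\<Sum>j<m. x $ j *
        (real (\<alpha> j) * monomial m (\<alpha>(j := \<alpha> j - 1)) (u + t \<cdot>\<^sub>v x))))) (at t)"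
    by (intro DERIV_sum DERIV_cmult monomial_has_derivative u x)
  moreover have "p (u + t \<cdot>\<^sub>v x) = (\<Sum>\<alpha>\<in>exponents m d. c \<alpha> * monomial m \<alpha> (u + t \<cdot>\<^sub>v x))" for t
    using u x by (intro p) simp
  moreover have "(\<Sum>\<alpha>\<in>exponents m d. c \<alpha> * (\<Sum>j<m. x $ j *
        (real (\<alpha> j) * monomial m (\<alpha>(j := \<alpha> j - 1)) (u + t \<cdot>\<^sub>v x))))
      = (\<Sum>j<m. x $ j * diff_poly m d c j (u + t \<cdot>\<^sub>v x))"
    unfolding diff_poly_def sum_distrib_left
    by (subst sum.swap) (simp add: mult_ac)
  ultimately show ?thesis by simp
qed

lemma partial_deriv_eq_diff_poly:
  assumes p: "\<And>u. u \<in> carrier_vec m \<Longrightarrow> p u = (\<Sum>\<alpha>\<in>exponents m d. c \<alpha> * monomial m \<alpha> u)"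
    and u: "u \<in> carrier_vec m" and j: "j < m"
  shows "partial_deriv j p u = diff_poly m d c j u"
proof -
  have "u + 0 \<cdot>\<^sub>v unit_vec m j = u" using u by auto
  moreover have "(\<Sum>i<m. unit_vec m j $ i * diff_poly m d c i u) = diff_poly m d c j u"
  proof -
    have "(\<Sum>i<m. unit_vec m j $ i * diff_poly m d c i u)
        = (\<Sum>i<m. if i = j then diff_poly m d c j u else 0)"
      using j by (intro sum.cong) auto
    then show ?thesis using j by simp
  qed
  ultimately have "((\<lambda>t. p (u + t \<cdot>\<^sub>v unit_vec m j)) has_real_derivative diff_poly m d c j u) (at 0)"
    using polynomial_fun_has_derivative_aux[OF p u unit_vec_carrier, where t = 0 and i1 = j] by simp
  then show ?thesis
    using u unfolding partial_deriv_def by (auto intro: DERIV_imp_deriv)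
qed

lemma polynomial_fun_has_derivative:
  assumes "polynomial_fun m d p" and u: "u \<in> carrier_vec m" and x: "x \<in> carrier_vec m"
  shows "((\<lambda>t. p (u + t \<cdot>\<^sub>v x)) has_real_derivative
    (\<Sum>j<m. x $ j * partial_deriv j p (u + t \<cdot>\<^sub>v x))) (at t)"
proof -
  obtain c where c: "\<And>u. u \<in> carrier_vec m \<Longrightarrow> p u = (\<Sum>\<alpha>\<in>exponents m d. c \<alpha> * monomial m \<alpha> u)"
    using polynomial_funE[OF assms(1)] by blast
  have "u + t \<cdot>\<^sub>v x \<in> carrier_vec m" using u x by simp
  then have "(\<Sum>j<m. x $ j * partial_deriv j p (u + t \<cdot>\<^sub>v x))
      = (\<Sum>j<m. x $ j * diff_poly m d c j (u + t \<cdot>\<^sub>v x))"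
    by (intro sum.cong refl) (simp add: partial_deriv_eq_diff_poly[OF c])
  then show ?thesis using polynomial_fun_has_derivative_aux[OF c u x] by simp
qed

lemma polydeg_partial_deriv:
  assumes "polynomial_fun m d p" "j < m"
  shows "polydeg m (d - 1) (partial_deriv j p)"
proof -
  obtain c where c: "\<And>u. u \<in> carrier_vec m \<Longrightarrow> p u = (\<Sum>\<alpha>\<in>exponents m d. c \<alpha> * monomial m \<alpha> u)"
    using polynomial_funE[OF assms(1)] by blast
  have "polydeg m (d - 1) (\<lambda>u. \<Sum>\<alpha>\<in>exponents m d. c \<alpha> * real (\<alpha> j) * monomial m (\<alpha>(j := \<alpha> j - 1)) u)"
  proof (rule polydeg_sum_monomials)
    fix \<alpha> assume \<alpha>: "\<alpha> \<in> exponents m d" "c \<alpha> * real (\<alpha> j) \<noteq> 0"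
    have "(\<Sum>i<m. \<alpha> i) = \<alpha> j + (\<Sum>i\<in>{..<m} - {j}. \<alpha> i)"
      using \<open>j < m\<close> by (intro sum.remove) auto
    moreover have "(\<Sum>i<m. (\<alpha>(j := \<alpha> j - 1)) i) = (\<alpha> j - 1) + (\<Sum>i\<in>{..<m} - {j}. \<alpha> i)"
      using \<open>j < m\<close> by (subst sum.remove[of _ j]) (auto intro: sum.cong)
    ultimately show "\<alpha>(j := \<alpha> j - 1) \<in> exponents_upto m (d - 1)"
      using \<alpha> by (auto simp: exponents_def exponents_upto_def)
  qed simp
  then show ?thesis
    using partial_deriv_eq_diff_poly[OF c _ assms(2)]
    unfolding polydeg_def diff_poly_def[symmetric] by simp
qed

text \<open>\<open>partial_deriv\<close> rests on \<open>deriv\<close>, which is linear only on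
  differentiable functions. Linearity is therefore taken from the formal derivatives, after choosing
  coefficients for every \<open>p k\<close>.\<close>

lemma polynomial_fun_linear_combination:
  assumes "finite K" and p: "\<And>k. k \<in> K \<Longrightarrow> polynomial_fun m d (p k)"
    and q: "\<And>u. u \<in> carrier_vec m \<Longrightarrow> q u = (\<Sum>k\<in>K. a k * p k u)"
  shows "polynomial_fun m d q"
    and "u \<in> carrier_vec m \<Longrightarrow> j < m \<Longrightarrow>
      partial_deriv j q u = (\<Sum>k\<in>K. a k * partial_deriv j (p k) u)"
proof -
  have "\<forall>k\<in>K. \<exists>c. \<forall>u\<in>carrier_vec m. p k u = (\<Sum>\<alpha>\<in>exponents m d. c \<alpha> * monomial m \<alpha> u)"
    using p unfolding polynomial_fun_def monomial_def by blast
  from bchoice[OF this] obtain c where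
    c: "\<And>k u. k \<in> K \<Longrightarrow> u \<in> carrier_vec m \<Longrightarrow> p k u = (\<Sum>\<alpha>\<in>exponents m d. c k \<alpha> * monomial m \<alpha> u)"
    by blast
  have e: "q u = (\<Sum>\<alpha>\<in>exponents m d. (\<Sum>k\<in>K. a k * c k \<alpha>) * monomial m \<alpha> u)"
    if "u \<in> carrier_vec m" for u
    unfolding q[OF that] sum_distrib_right
    by (subst sum.swap) (simp add: c that sum_distrib_left mult.assoc)
  then show "polynomial_fun m d q"
    unfolding polynomial_fun_def monomial_def
    by (intro exI[of _ "\<lambda>\<alpha>. \<Sum>k\<in>K. a k * c k \<alpha>"]) blast
  show "partial_deriv j q u = (\<Sum>k\<in>K. a k * partial_deriv j (p k) u)"
    if u: "u \<in> carrier_vec m" and j: "j < m"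
  proof -
    have "partial_deriv j q u = diff_poly m d (\<lambda>\<alpha>. \<Sum>k\<in>K. a k * c k \<alpha>) j u"
      by (rule partial_deriv_eq_diff_poly[OF e u j])
    also have "\<dots> = (\<Sum>k\<in>K. a k * diff_poly m d (c k) j u)"
      unfolding diff_poly_def sum_distrib_right sum_distrib_left
      by (subst sum.swap) (simp add: mult.assoc)
    also have "\<dots> = (\<Sum>k\<in>K. a k * partial_deriv j (p k) u)"
      by (intro sum.cong refl) (simp add: partial_deriv_eq_diff_poly[OF c u j])
    finally show ?thesis .
  qed
qed

lemma polynomial_fun_zero:
  assumes "polynomial_fun m d p"
  shows "p (0\<^sub>v m) = 0"
proof -
  obtain c where c: "\<And>u. u \<in> carrier_vec m \<Longrightarrow> p u = (\<Sum>\<alpha>\<in>exponents m d. c \<alpha> * monomial m \<alpha> u)"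
    using polynomial_funE[OF assms] by blast
  have "monomial m \<alpha> (0\<^sub>v m) = 0" if "\<alpha> \<in> exponents m d" for \<alpha>
  proof -
    have "(\<Sum>i<m. \<alpha> i) \<noteq> 0" using that by (simp add: exponents_def del: sum_eq_0_iff)
    then obtain i where "i \<in> {..<m}" "\<alpha> i \<noteq> 0" by (rule sum.not_neutral_contains_not_neutral)
    then show ?thesis unfolding monomial_def by (intro prod_zero bexI[of _ i]) auto
  qed
  then show ?thesis using c[of "0\<^sub>v m"] by simp
qed

lemma polynomial_fun_constant_along:
  assumes "polynomial_fun m d p" and u: "u \<in> carrier_vec m" and x: "x \<in> carrier_vec m"
    and "\<And>v. v \<in> carrier_vec m \<Longrightarrow> (\<Sum>j<m. x $ j * partial_deriv j p v) = 0"
  shows "p (u + x) = p u"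
proof -
  have "((\<lambda>t. p (u + t \<cdot>\<^sub>v x)) has_real_derivative 0) (at t)" for t
    using polynomial_fun_has_derivative[OF assms(1) u x, of t] assms(4)[of "u + t \<cdot>\<^sub>v x"] u x by simp
  then have "p (u + 1 \<cdot>\<^sub>v x) = p (u + 0 \<cdot>\<^sub>v x)"
    using DERIV_isconst_all[of "\<lambda>t. p (u + t \<cdot>\<^sub>v x)"] by blast
  moreover have "u + 0 \<cdot>\<^sub>v x = u" using u x by auto
  ultimately show ?thesis by simp
qed

lemma partial_deriv_ridge:
  assumes v: "v \<in> carrier_vec m" and u: "u \<in> carrier_vec m" and j: "j < m"
    and p: "\<And>u. u \<in> carrier_vec m \<Longrightarrow> p u = a * poly g (v \<bullet> u)"
  shows "partial_deriv j p u = a * v $ j * poly (pderiv g) (v \<bullet> u)"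
proof -
  have "p (u + t \<cdot>\<^sub>v unit_vec m j) = a * poly g (v \<bullet> u + t * v $ j)" for t
    using u v j by (simp add: p scalar_prod_add_distrib[of _ m])
  moreover have "((\<lambda>t. a * poly g (v \<bullet> u + t * v $ j)) has_real_derivative
      a * (poly (pderiv g) (v \<bullet> u + 0 * v $ j) * v $ j)) (at 0)"
    by (intro DERIV_cmult DERIV_chain2[OF poly_DERIV]) (auto intro!: derivative_eq_intros)
  ultimately show ?thesis
    using u DERIV_imp_deriv unfolding partial_deriv_def by fastforce
qed

text \<open>By the chain rule the partial derivatives are \<open>w $ i * v $ j\<close> times the
  derivative of \<open>g\<close> at the projected point; its values at the sampling points form the
  third vector.\<close>

lemma ridge_map_J_tensor_outer3:
  assumes U: "\<forall>l<N. U l \<in> carrier_vec m" and ridge: "ridge_map n m d w v g p"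
  shows "\<exists>a b c. a \<in> carrier_vec n \<and> b \<in> carrier_vec m \<and> c \<in> carrier_vec N \<and>
    J_tensor n m N U p = outer3 a b c"
proof -
  define c where "c = Matrix.vec N (\<lambda>l. poly (pderiv g) (v \<bullet> U l))"
  have wv: "w \<in> carrier_vec n" "v \<in> carrier_vec m" using ridge by (auto simp: ridge_map_def)
  have "partial_deriv j (\<lambda>u. p u $ i) (U l) = w $ i * v $ j * c $ l" if "i < n" "j < m" "l < N" for i j l
    using partial_deriv_ridge[OF wv(2), of "U l" j "\<lambda>u. p u $ i" "w $ i" g] U that ridge
    by (simp add: c_def ridge_map_def)
  then have "J_tensor n m N U p = outer3 w v c"
    using wv unfolding outer3_def by (intro ext) (auto simp: J_tensor_def tensor3_def c_def)
  then show ?thesis using wv by (intro exI[of _ w] exI[of _ v] exI[of _ c]) (auto simp: c_def)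
qed

section \<open>Consequences of the rank condition\<close>

locale sampling =
  fixes m d N :: nat and U :: "nat \<Rightarrow> real vec"
  assumes m: "m \<ge> 1" and d: "d \<ge> 1" and U: "\<forall>l<N. U l \<in> carrier_vec m"
    and rank: "vec_space.rank (Delta m d) (vandermonde_mat m d N U) = (m + d - 1) choose (d - 1)"
begin

lemma polydeg_vanishes:
  assumes "polydeg m (d - 1) q" "\<And>l. l < N \<Longrightarrow> q (U l) = 0" "u \<in> carrier_vec m"
  shows "q u = 0"
  by (rule evaluation_injective[OF m d U rank assms])

text \<open>The partial derivatives have degree at most d - 1, hence vanish identically, and
  \<open>p\<close> is constant. Jacobians do not see constants; the missing constant term is what
  forces \<open>p\<close> to be 0.\<close>

lemma polynomial_fun_vanishes:
  assumes p: "polynomial_fun m d p"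
    and zero: "\<And>j l. j < m \<Longrightarrow> l < N \<Longrightarrow> partial_deriv j p (U l) = 0"
    and u: "u \<in> carrier_vec m"
  shows "p u = 0"
proof -
  have "partial_deriv j p v = 0" if "j < m" "v \<in> carrier_vec m" for j v
    using polydeg_vanishes[OF polydeg_partial_deriv[OF p]] zero that by blast
  then have "p (0\<^sub>v m + u) = p (0\<^sub>v m)"
    by (intro polynomial_fun_constant_along[OF p _ u]) auto
  then show ?thesis using u polynomial_fun_zero[OF p] by simp
qed

lemma J_tensor_sum_iff:
  assumes f: "f \<in> polynomial_maps n m d"
    and p: "\<And>k. k < r \<Longrightarrow> p k \<in> polynomial_maps n m d"
  shows "J_tensor n m N U f = tensor_sum r (\<lambda>k. J_tensor n m N U (p k)) \<longleftrightarrow>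
    (\<forall>u\<in>carrier_vec m. \<forall>i<n. f u $ i = (\<Sum>k<r. p k u $ i))" (is "?L \<longleftrightarrow> ?R")
proof
  have pf: "polynomial_fun m d (\<lambda>u. f u $ i)" if "i < n" for i
    using f that by (simp add: polynomial_maps_def)
  have pp: "polynomial_fun m d (\<lambda>u. p k u $ i)" if "i < n" "k < r" for i k
    using p that by (simp add: polynomial_maps_def)
  show ?R if ?L
  proof (intro ballI allI impI)
    fix u :: "real vec" and i assume u: "u \<in> carrier_vec m" and i: "i < n"
    \<comment> \<open>The difference of \<open>f\<close> and the sum of the \<open>p k\<close> as
      one linear combination over \<open>{..<Suc r}\<close>: \<open>f\<close> sits at index
      \<open>r\<close> with coefficient 1, the \<open>p k\<close> have coefficient -1.\<close>
    define h where "h = (\<lambda>k u. if k < r then p k u $ i else (f u :: real vec) $ i)"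
    define a where "a = (\<lambda>k. if k < r then - 1 else 1 :: real)"
    have h: "polynomial_fun m d (h k)" for k
      using pf pp i by (cases "k < r") (simp_all add: h_def)
    note lin = polynomial_fun_linear_combination[of "{..<Suc r}" m d h
        "\<lambda>u. \<Sum>k<Suc r. a k * h k u" a, OF finite_lessThan h refl]
    have "partial_deriv j (\<lambda>u. \<Sum>k<Suc r. a k * h k u) (U l) = 0" if j: "j < m" and l: "l < N" for j l
    proof -
      have "partial_deriv j (\<lambda>u. f u $ i) (U l) = (\<Sum>k<r. partial_deriv j (\<lambda>u. p k u $ i) (U l))"
        using fun_cong[OF fun_cong[OF fun_cong[OF \<open>?L\<close>]], of i j l] i j l
        by (simp add: J_tensor_def tensor3_def tensor_sum_def)
      then show ?thesis
        using lin(2) U j l by (simp add: a_def h_def sum_negf)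
    qed
    from polynomial_fun_vanishes[OF lin(1) this u]
    show "f u $ i = (\<Sum>k<r. p k u $ i)" by (simp add: a_def h_def sum_negf)
  qed
  show ?L if ?R
  proof (intro ext)
    fix i j l
    have "partial_deriv j (\<lambda>u. f u $ i) (U l) = (\<Sum>k<r. 1 * partial_deriv j (\<lambda>u. p k u $ i) (U l))"
      if "i < n" "j < m" "l < N"
      using pp that \<open>?R\<close> U
      by (intro polynomial_fun_linear_combination(2)[of "{..<r}" m d]) auto
    then show "J_tensor n m N U f i j l = tensor_sum r (\<lambda>k. J_tensor n m N U (p k)) i j l"
      by (auto simp: J_tensor_def tensor3_def tensor_sum_def)
  qed
qed

lemma polynomial_fun_gradient_direction:
  fixes b :: "real vec"
  assumes h: "polynomial_fun m d h" and b: "b \<in> carrier_vec m" and k: "k < m" "b $ k \<noteq> 0"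
    and minors: "\<And>j l. j < m \<Longrightarrow> l < N \<Longrightarrow> b $ k * partial_deriv j h (U l) = b $ j * partial_deriv k h (U l)"
  shows "\<exists>g. degree g \<le> d \<and> coeff g 0 = 0 \<and> (\<forall>u\<in>carrier_vec m. h u = poly g (b \<bullet> u))"
proof -
  have par: "b $ k * partial_deriv j h u = b $ j * partial_deriv k h u"
    if "j < m" "u \<in> carrier_vec m" for j u
    using polydeg_vanishes[OF polydeg_diff[OF polydeg_partial_deriv[OF h \<open>j < m\<close>]
        polydeg_partial_deriv[OF h k(1)], of "b $ k" "b $ j"]] minors that by fastforce
  obtain c where c: "\<And>u. u \<in> carrier_vec m \<Longrightarrow> h u = (\<Sum>\<alpha>\<in>exponents m d. c \<alpha> * monomial m \<alpha> u)"
    using polynomial_funE[OF h] by blast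
  \<comment> \<open>Scaled so that \<open>b \<bullet> e = 1\<close>; then
    \<open>(b \<bullet> u) \<cdot>\<^sub>v e\<close> is the projection of \<open>u\<close> onto the
    line of \<open>e\<close> along the hyperplane orthogonal to \<open>b\<close>.\<close>
  define e where "e = (1 / b $ k) \<cdot>\<^sub>v unit_vec m k"
  have e: "e \<in> carrier_vec m" by (simp add: e_def)
  have be: "b \<bullet> e = 1" using b k by (simp add: e_def)
  \<comment> \<open>The restriction of \<open>h\<close> to the line,
    \<open>poly g t = h (t \<cdot>\<^sub>v e)\<close>: a monomial of total degree q contributes a
    multiple of the q-th power of t.\<close>
  define g where "g = (\<Sum>\<alpha>\<in>exponents m d. monom (c \<alpha> * monomial m \<alpha> e) (\<Sum>i<m. \<alpha> i))"
  have "degree g \<le> d" unfolding g_def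
    by (rule degree_sum_le[OF finite_exponents])
      (auto simp: exponents_def intro: order_trans[OF degree_monom_le])
  moreover have "coeff g 0 = 0"
    unfolding g_def coeff_sum by (intro sum.neutral) (auto simp: exponents_def)
  moreover have "h u = poly g (b \<bullet> u)" if u: "u \<in> carrier_vec m" for u
  proof -
    let ?t = "b \<bullet> u"
    define x where "x = u - ?t \<cdot>\<^sub>v e"
    have x: "x \<in> carrier_vec m" using u e by (simp add: x_def)
    have "b \<bullet> x = 0"
      using b u e be by (simp add: x_def scalar_prod_minus_distrib[of _ m])
    then have bx: "(\<Sum>j<m. x $ j * b $ j) = 0"
      using x by (simp add: scalar_prod_def atLeast0LessThan mult.commute)
    have "(\<Sum>j<m. x $ j * partial_deriv j h v) = 0" if "v \<in> carrier_vec m" for v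
    proof -
      \<comment> \<open>Multiplying by the nonzero \<open>b $ k\<close> lets the parallel gradient
        replace every partial derivative by the \<open>k\<close>-th one.\<close>
      have "b $ k * (\<Sum>j<m. x $ j * partial_deriv j h v)
          = (\<Sum>j<m. x $ j * b $ j) * partial_deriv k h v"
        unfolding sum_distrib_left sum_distrib_right
        using par that by (intro sum.cong) (auto simp: mult_ac)
      with bx k show ?thesis by simp
    qed
    then have "h (?t \<cdot>\<^sub>v e + x) = h (?t \<cdot>\<^sub>v e)"
      using e x by (intro polynomial_fun_constant_along[OF h]) auto
    moreover have "?t \<cdot>\<^sub>v e + x = u" using u e by (auto simp: x_def)
    moreover have "monomial m \<alpha> (?t \<cdot>\<^sub>v e) = monomial m \<alpha> e * ?t ^ (\<Sum>i<m. \<alpha> i)" for \<alpha>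
      using e by (simp add: monomial_def power_mult_distrib prod.distrib power_sum mult.commute)
    ultimately show ?thesis
      using c[of "?t \<cdot>\<^sub>v e"] e by (simp add: g_def poly_sum poly_monom mult.assoc)
  qed
  ultimately show ?thesis by blast
qed

text \<open>A component \<open>i0\<close> with \<open>a $ i0 \<noteq> 0\<close> supplies the
  univariate polynomial. The other components are multiples of it, as
  \<open>a $ i0 * p u $ i\<close> and \<open>a $ i * p u $ i0\<close> have the same gradients at the
  sampling points.\<close>

lemma J_tensor_outer3_imp_ridge:
  assumes p: "p \<in> polynomial_maps n m d"
    and abc: "a \<in> carrier_vec n" "b \<in> carrier_vec m" "c \<in> carrier_vec N"
    and J: "J_tensor n m N U p = outer3 a b c"
  shows "\<exists>w v g. ridge_map n m d w v g p"
proof -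
  have pp: "polynomial_fun m d (\<lambda>u. p u $ i)" if "i < n" for i
    using p that by (simp add: polynomial_maps_def)
  have pn: "p u \<in> carrier_vec n" if "u \<in> carrier_vec m" for u
    using p that by (auto simp: polynomial_maps_def)
  have fac: "partial_deriv j (\<lambda>u. p u $ i) (U l) = a $ i * b $ j * c $ l"
    if "i < n" "j < m" "l < N" for i j l
    using fun_cong[OF fun_cong[OF fun_cong[OF J]], of i j l] that abc
    by (simp add: J_tensor_def outer3_def tensor3_def)
  show ?thesis
  proof (cases "(\<exists>i<n. a $ i \<noteq> 0) \<and> (\<exists>j<m. b $ j \<noteq> 0)")
    case False
    have "p u $ i = 0" if "u \<in> carrier_vec m" "i < n" for u i
      using polynomial_fun_vanishes[OF pp[OF \<open>i < n\<close>] _ \<open>u \<in> carrier_vec m\<close>] fac False \<open>i < n\<close> by auto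
    then have "ridge_map n m d (0\<^sub>v n) (0\<^sub>v m) 0 p" using pn by (simp add: ridge_map_def)
    then show ?thesis by blast
  next
    case True
    then obtain i0 k where i0: "i0 < n" "a $ i0 \<noteq> 0" and k: "k < m" "b $ k \<noteq> 0" by blast
    obtain g where g: "degree g \<le> d" "coeff g 0 = 0"
        "\<And>u. u \<in> carrier_vec m \<Longrightarrow> p u $ i0 = poly g (b \<bullet> u)"
      using polynomial_fun_gradient_direction[OF pp[OF i0(1)] abc(2) k] fac i0(1) k(1)
      by (auto simp: mult_ac)
    define w where "w = Matrix.vec n (\<lambda>i. a $ i / a $ i0)"
    have "p u $ i = w $ i * poly g (b \<bullet> u)" if u: "u \<in> carrier_vec m" and i: "i < n" for u i
    proof -
      \<comment> \<open>The Booleans index the two-term combination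
        \<open>a $ i * p u $ i0 - a $ i0 * p u $ i\<close>.\<close>
      define h where "h = (\<lambda>q u. (p u :: real vec) $ (if q then i0 else i))"
      define \<kappa> where "\<kappa> = (\<lambda>q. if q then a $ i else - a $ i0)"
      have h: "polynomial_fun m d (h q)" for q
        using pp i0 i by (simp add: h_def)
      note lin = polynomial_fun_linear_combination[of UNIV m d h
          "\<lambda>u. \<Sum>q\<in>UNIV. \<kappa> q * h q u" \<kappa>, OF finite h refl]
      have "partial_deriv j (\<lambda>u. \<Sum>q\<in>UNIV. \<kappa> q * h q u) (U l) = 0" if "j < m" "l < N" for j l
        using lin(2) fac i i0(1) U that by (simp add: h_def \<kappa>_def UNIV_bool)
      from polynomial_fun_vanishes[OF lin(1) this u]
      have "a $ i0 * p u $ i = a $ i * p u $ i0" by (simp add: h_def \<kappa>_def UNIV_bool)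
      then show ?thesis using i0(2) i g(3)[OF u] by (simp add: w_def field_simps)
    qed
    then have "ridge_map n m d w b g p" using abc g pn by (simp add: ridge_map_def w_def)
    then show ?thesis by blast
  qed
qed

end

section \<open>CP decompositions\<close>

text \<open>\<open>cp_rank\<close> is a \<open>LEAST\<close>, which is informative only if some
  decomposition exists. Here each pair (i, j), coded as \<open>q = i * m + j\<close>, contributes
  its fibre in the third direction.\<close>

lemma cp_decomposition_exists:
  "\<exists>R a b c. (\<forall>q<R. a q \<in> carrier_vec n \<and> b q \<in> carrier_vec m \<and> c q \<in> carrier_vec K) \<and>
     tensor3 n m K F = tensor_sum R (\<lambda>q. outer3 (a q) (b q) (c q))"
proof -
  define a where "a = (\<lambda>q. unit_vec n (q div m) :: real vec)"
  define b where "b = (\<lambda>q. unit_vec m (q mod m) :: real vec)"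
  define c where "c = (\<lambda>q. Matrix.vec K (\<lambda>k. F (q div m) (q mod m) k))"
  have "tensor3 n m K F = tensor_sum (n * m) (\<lambda>q. outer3 (a q) (b q) (c q))"
  proof (intro ext)
    fix i j k
    show "tensor3 n m K F i j k = tensor_sum (n * m) (\<lambda>q. outer3 (a q) (b q) (c q)) i j k"
    proof (cases "i < n \<and> j < m \<and> k < K")
      case True
      then have "Suc i * m \<le> n * m" by (intro mult_le_mono1) simp
      with True have ij: "i * m + j < n * m" by simp
      have "outer3 (a q) (b q) (c q) i j k = (if q = i * m + j then F i j k else 0)"
        if "q < n * m" for q
      proof -
        have "q div m < n" using that by (simp add: less_mult_imp_div_less)
        moreover have "q = i * m + j \<longleftrightarrow> i = q div m \<and> j = q mod m" using True by auto
        ultimately show ?thesis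
          using True by (auto simp: outer3_def tensor3_def a_def b_def c_def)
      qed
      then show ?thesis using True ij by (simp add: tensor_sum_def tensor3_def)
    qed (auto simp: tensor3_def tensor_sum_def outer3_def a_def b_def c_def)
  qed
  moreover have "\<forall>q<n * m. a q \<in> carrier_vec n \<and> b q \<in> carrier_vec m \<and> c q \<in> carrier_vec K"
    by (simp add: a_def b_def c_def)
  ultimately show ?thesis by blast
qed

lemma cp_rank_1_imp_outer3:
  assumes "cp_rank n m K T = 1" "T = tensor3 n m K F"
  shows "\<exists>a b c. a \<in> carrier_vec n \<and> b \<in> carrier_vec m \<and> c \<in> carrier_vec K \<and> T = outer3 a b c"
proof -
  let ?P = "\<lambda>R. \<exists>a b c.
        (\<forall>q<R. a q \<in> carrier_vec n \<and> b q \<in> carrier_vec m \<and> c q \<in> carrier_vec K) \<and>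
        T = tensor_sum R (\<lambda>q. outer3 (a q) (b q) (c q))"
  have "\<exists>R. ?P R" unfolding assms(2) by (rule cp_decomposition_exists)
  then have "?P (LEAST R. ?P R)" by (rule LeastI_ex)
  then have "?P 1" using assms(1) unfolding cp_rank_def by simp
  then obtain a b c where abc: "a 0 \<in> carrier_vec n" "b 0 \<in> carrier_vec m" "c 0 \<in> carrier_vec K"
    "T = tensor_sum 1 (\<lambda>q. outer3 (a q) (b q) (c q))" by auto
  then have "T = outer3 (a 0) (b 0) (c 0)" by (simp add: tensor_sum_def)
  with abc show ?thesis by blast
qed

text \<open>A nonzero tensor is not the empty sum, so zero terms do not suffice.\<close>

lemma cp_rank_outer3:
  assumes "a \<in> carrier_vec n" "b \<in> carrier_vec m" "c \<in> carrier_vec K"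
    and "outer3 a b c \<noteq> (\<lambda>i j k. 0)"
  shows "cp_rank n m K (outer3 a b c) = 1"
  unfolding cp_rank_def
proof (rule Least_equality)
  show "\<exists>a' b' c'. (\<forall>q<1. a' q \<in> carrier_vec n \<and> b' q \<in> carrier_vec m \<and> c' q \<in> carrier_vec K) \<and>
      outer3 a b c = tensor_sum 1 (\<lambda>q. outer3 (a' q) (b' q) (c' q))"
    using assms by (intro exI[of _ "\<lambda>_. a"] exI[of _ "\<lambda>_. b"] exI[of _ "\<lambda>_. c"])
      (simp add: tensor_sum_def)
next
  fix R assume *: "\<exists>a' b' c'. (\<forall>q<R. a' q \<in> carrier_vec n \<and> b' q \<in> carrier_vec m \<and> c' q \<in> carrier_vec K) \<and>
      outer3 a b c = tensor_sum R (\<lambda>q. outer3 (a' q) (b' q) (c' q))"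
  show "1 \<le> R"
  proof (rule ccontr)
    assume "\<not> 1 \<le> R"
    then have "R = 0" by simp
    with * assms(4) show False by (auto simp: tensor_sum_def)
  qed
qed

text \<open>A vanishing term has CP rank 0, so it is removed by sharing a nonvanishing term among all the
  vanishing ones; if every term vanishes, a nonzero ridge function is used with coefficients
  summing to 0, which requires \<open>r \<ge> 2\<close>.\<close>

lemma nonzero_ridge_terms:
  fixes w v :: "nat \<Rightarrow> real vec"
  assumes "n \<ge> 1" "m \<ge> 1" "d \<ge> 1" "r \<ge> 1"
    and data: "\<And>k. k < r \<Longrightarrow> ridge_data n m d (w k) (v k) (g k)"
    and nz: "r = 1 \<Longrightarrow> \<exists>u\<in>carrier_vec m. \<exists>i<n. (\<Sum>k<r. w k $ i * poly (g k) (v k \<bullet> u)) \<noteq> 0"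
  shows "\<exists>w' v' g'. (\<forall>k<r. ridge_data n m d (w' k) (v' k) (g' k) \<and>
        (\<exists>u\<in>carrier_vec m. \<exists>i<n. w' k $ i * poly (g' k) (v' k \<bullet> u) \<noteq> 0)) \<and>
      (\<forall>u\<in>carrier_vec m. \<forall>i<n. (\<Sum>k<r. w' k $ i * poly (g' k) (v' k \<bullet> u)) =
        (\<Sum>k<r. w k $ i * poly (g k) (v k \<bullet> u)))"
proof -
  define T where "T = (\<lambda>k u i. w k $ i * poly (g k) (v k \<bullet> u))"
  define nonzero where "nonzero = (\<lambda>k. \<exists>u\<in>carrier_vec m. \<exists>i<n. T k u i \<noteq> 0)"
  show ?thesis
  proof (cases "\<exists>k<r. nonzero k")
    case True
    then obtain k0 where k0: "k0 < r" "nonzero k0" by blast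
    \<comment> \<open>\<open>k0\<close> belongs to \<open>Z\<close>: its term is cut into
      \<open>card Z\<close> equal shares, one for every index in \<open>Z\<close>, where all other
      old terms vanish.\<close>
    define Z where "Z = insert k0 {k. k < r \<and> \<not> nonzero k}"
    have Z: "Z \<subseteq> {..<r}" "finite Z" using k0 by (auto simp: Z_def)
    define N where "N = real (card Z)"
    have N: "N \<noteq> 0" using Z by (auto simp: N_def Z_def card_eq_0_iff)
    define w' where "w' = (\<lambda>k. if k \<in> Z then (1 / N) \<cdot>\<^sub>v w k0 else w k)"
    define v' where "v' = (\<lambda>k. if k \<in> Z then v k0 else v k)"
    define g' where "g' = (\<lambda>k. if k \<in> Z then g k0 else g k)"
    have T': "w' k $ i * poly (g' k) (v' k \<bullet> u) = (if k \<in> Z then T k0 u i / N else T k u i)"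
      if "i < n" "k < r" for k u i
      using that data[OF k0(1)] by (auto simp: w'_def v'_def g'_def T_def)
    have "\<exists>u\<in>carrier_vec m. \<exists>i<n. w' k $ i * poly (g' k) (v' k \<bullet> u) \<noteq> 0" if k: "k < r" for k
    proof (cases "k \<in> Z")
      case True
      obtain u i where "u \<in> carrier_vec m" "i < n" "T k0 u i \<noteq> 0"
        using k0(2) unfolding nonzero_def by blast
      with True T'[OF _ k, of i u] N show ?thesis by (intro bexI[of _ u] exI[of _ i]) auto
    next
      case False
      with k have "nonzero k" by (simp add: Z_def)
      then obtain u i where "u \<in> carrier_vec m" "i < n" "T k u i \<noteq> 0"
        unfolding nonzero_def by blast
      with False T'[OF _ k, of i u] show ?thesis by (intro bexI[of _ u] exI[of _ i]) auto
    qed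
    moreover have "ridge_data n m d (w' k) (v' k) (g' k)" if "k < r" for k
      using data[OF that] data[OF k0(1)] by (simp add: w'_def v'_def g'_def)
    moreover have "(\<Sum>k<r. w' k $ i * poly (g' k) (v' k \<bullet> u)) = (\<Sum>k<r. T k u i)"
      if u: "u \<in> carrier_vec m" and i: "i < n" for u i
    proof -
      have "(\<Sum>k<r. w' k $ i * poly (g' k) (v' k \<bullet> u))
          = (\<Sum>k<r. if k \<in> Z then T k0 u i / N else T k u i)"
        using T' i by (intro sum.cong) auto
      also have "\<dots> = (\<Sum>k\<in>{..<r} - Z. T k u i) + (\<Sum>k\<in>Z. T k0 u i / N)"
        by (subst sum.subset_diff[OF Z(1)]) auto
      also have "(\<Sum>k\<in>Z. T k0 u i / N) = T k0 u i" using N by (simp add: N_def)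
      also have "T k0 u i = (\<Sum>k\<in>Z. T k u i)"
        using u i Z k0 by (subst sum.remove[of _ k0]) (auto simp: Z_def nonzero_def intro!: sum.neutral)
      also have "(\<Sum>k\<in>{..<r} - Z. T k u i) + (\<Sum>k\<in>Z. T k u i) = (\<Sum>k<r. T k u i)"
        by (subst sum.subset_diff[OF Z(1)]) auto
      finally show ?thesis .
    qed
    ultimately show ?thesis unfolding T_def by blast
  next
    case False
    then have zero: "(\<Sum>k<r. w k $ i * poly (g k) (v k \<bullet> u)) = 0"
      if "u \<in> carrier_vec m" "i < n" for u i
      using that by (intro sum.neutral) (auto simp: nonzero_def T_def)
    with nz have "r \<noteq> 1" by blast
    \<comment> \<open>Coefficients for r copies of the same linear ridge function: r - 1 ones and 1
      - r, which is nonzero because r is not 1, with sum 0.\<close>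
    define \<kappa> where "\<kappa> = (\<lambda>k::nat. if k = 0 then 1 - real r else 1)"
    have "(\<Sum>k<r. \<kappa> k) = \<kappa> 0 + (\<Sum>k\<in>{..<r} - {0}. 1)"
      using \<open>r \<ge> 1\<close> by (subst sum.remove[of _ 0]) (auto simp: \<kappa>_def)
    also have "\<dots> = 0" using \<open>r \<ge> 1\<close> by (simp add: \<kappa>_def)
    finally have \<kappa>: "(\<Sum>k<r. \<kappa> k) = 0" .
    define w' where "w' = (\<lambda>k. \<kappa> k \<cdot>\<^sub>v unit_vec n 0)"
    define e :: "real vec" where "e = unit_vec m 0"
    have e: "e \<in> carrier_vec m" "e \<bullet> e = 1" using \<open>m \<ge> 1\<close> by (auto simp: e_def)
    have "\<exists>u\<in>carrier_vec m. \<exists>i<n. w' k $ i * poly [:0, 1:] (e \<bullet> u) \<noteq> 0" for k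
      using e \<open>n \<ge> 1\<close> \<open>r \<noteq> 1\<close>
      by (intro bexI[of _ e] exI[of _ 0]) (auto simp: w'_def \<kappa>_def)
    moreover have "ridge_data n m d (w' k) e [:0, 1:]" for k
      using e \<open>d \<ge> 1\<close> by (simp add: w'_def)
    moreover have "(\<Sum>k<r. w' k $ i * poly [:0, 1:] (e \<bullet> u)) = 0" if "i < n" for u i
    proof -
      have "(\<Sum>k<r. w' k $ i * poly [:0, 1:] (e \<bullet> u)) = (\<Sum>k<r. \<kappa> k) * (unit_vec n 0 $ i * (e \<bullet> u))"
        unfolding sum_distrib_right using that by (intro sum.cong) (auto simp: w'_def)
      then show ?thesis using \<kappa> by simp
    qed
    ultimately show ?thesis using zero
      by (intro exI[of _ w'] exI[of _ "\<lambda>_. e"] exI[of _ "\<lambda>_. [:0, 1:]"]) simp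
  qed
qed

lemma finsum_vec_ridge_index:
  fixes w v :: "nat \<Rightarrow> real vec"
  assumes "\<And>k. k < r \<Longrightarrow> w k \<in> carrier_vec n" "i < n"
  shows "finsum_vec TYPE(real) n (\<lambda>k. poly (g k) (v k \<bullet> u) \<cdot>\<^sub>v w k) {..<r} $ i
    = (\<Sum>k<r. w k $ i * poly (g k) (v k \<bullet> u))"
proof -
  have "(poly (g k) (v k \<bullet> u) \<cdot>\<^sub>v w k) $ i = w k $ i * poly (g k) (v k \<bullet> u)" if "k < r" for k
    using assms(1)[OF that] assms(2) by simp
  then show ?thesis using assms by (subst index_finsum_vec) auto
qed

lemma eq_finsum_vec_ridge_iff:
  fixes w v :: "nat \<Rightarrow> real vec"
  assumes "x \<in> carrier_vec n" "\<And>k. k < r \<Longrightarrow> w k \<in> carrier_vec n"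
  shows "x = finsum_vec TYPE(real) n (\<lambda>k. poly (g k) (v k \<bullet> u) \<cdot>\<^sub>v w k) {..<r} \<longleftrightarrow>
    (\<forall>i<n. x $ i = (\<Sum>k<r. w k $ i * poly (g k) (v k \<bullet> u)))"
proof -
  have "finsum_vec TYPE(real) n (\<lambda>k. poly (g k) (v k \<bullet> u) \<cdot>\<^sub>v w k) {..<r} \<in> carrier_vec n"
    using assms(2) by (intro finsum_vec_closed) auto
  with assms show ?thesis
    using finsum_vec_ridge_index[of r w n _ g v u] by (auto intro!: eq_vecI)
qed

text \<open>\<open>\<Phi>\<close> stands for either tensor map and \<open>K\<close> for its third
  dimension, so that both equivalences of the theorem are instances of one argument.\<close>

lemma ridge_decomposition_iff:
  fixes \<Phi> :: "(real vec \<Rightarrow> real vec) \<Rightarrow> tensor3"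
  assumes "n \<ge> 1" "m \<ge> 1" "d \<ge> 1" "r \<ge> 1"
    and f: "f \<in> polynomial_maps n m d" and nz: "r = 1 \<Longrightarrow> \<exists>u\<in>carrier_vec m. f u \<noteq> 0\<^sub>v n"
    and sum_iff: "\<And>r f p. f \<in> polynomial_maps n m d \<Longrightarrow>
      (\<And>k. k < r \<Longrightarrow> p k \<in> polynomial_maps n m d) \<Longrightarrow>
      \<Phi> f = tensor_sum r (\<lambda>k. \<Phi> (p k)) \<longleftrightarrow>
      (\<forall>u\<in>carrier_vec m. \<forall>i<n. f u $ i = (\<Sum>k<r. p k u $ i))"
    and shape: "\<And>p. \<exists>F. \<Phi> p = tensor3 n m K F"
    and outer3: "\<And>w v g p. ridge_map n m d w v g p \<Longrightarrow>
      \<exists>a b c. a \<in> carrier_vec n \<and> b \<in> carrier_vec m \<and> c \<in> carrier_vec K \<and> \<Phi> p = outer3 a b c"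
    and ridge: "\<And>p a b c. p \<in> polynomial_maps n m d \<Longrightarrow> a \<in> carrier_vec n \<Longrightarrow>
      b \<in> carrier_vec m \<Longrightarrow> c \<in> carrier_vec K \<Longrightarrow> \<Phi> p = outer3 a b c \<Longrightarrow>
      \<exists>w v g. ridge_map n m d w v g p"
  shows "(\<exists>(w :: nat \<Rightarrow> real vec) (v :: nat \<Rightarrow> real vec) (g :: nat \<Rightarrow> real poly).
         (\<forall>k<r. ridge_data n m d (w k) (v k) (g k)) \<and>
         (\<forall>u \<in> carrier_vec m.
            f u = finsum_vec TYPE(real) n (\<lambda>k. poly (g k) (v k \<bullet> u) \<cdot>\<^sub>v w k) {..<r})) \<longleftrightarrow>
    (\<exists>T. \<Phi> f = tensor_sum r T \<and>
         (\<forall>k<r. cp_rank n m K (T k) = 1 \<and> T k \<in> \<Phi> ` polynomial_maps n m d))"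
    (is "?L \<longleftrightarrow> ?R")
proof
  have fn: "f u \<in> carrier_vec n" if "u \<in> carrier_vec m" for u
    using f that by (simp add: polynomial_maps_def)
  show ?R if ?L
  proof -
    obtain w v :: "nat \<Rightarrow> real vec" and g where
      data: "\<And>k. k < r \<Longrightarrow> ridge_data n m d (w k) (v k) (g k)"
      and dec: "\<And>u. u \<in> carrier_vec m \<Longrightarrow>
        f u = finsum_vec TYPE(real) n (\<lambda>k. poly (g k) (v k \<bullet> u) \<cdot>\<^sub>v w k) {..<r}"
      using \<open>?L\<close> by blast
    have fsum: "f u $ i = (\<Sum>k<r. w k $ i * poly (g k) (v k \<bullet> u))"
      if "u \<in> carrier_vec m" "i < n" for u i
      using eq_finsum_vec_ridge_iff[OF fn[OF that(1)], of r w g v u] data dec that by blast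
    have "\<exists>u\<in>carrier_vec m. \<exists>i<n. (\<Sum>k<r. w k $ i * poly (g k) (v k \<bullet> u)) \<noteq> 0" if r1: "r = 1"
    proof -
      obtain u where u: "u \<in> carrier_vec m" "f u \<noteq> 0\<^sub>v n" using nz[OF r1] by blast
      have "\<exists>i<n. f u $ i \<noteq> 0"
      proof (rule ccontr)
        assume "\<not> ?thesis"
        then have "f u = 0\<^sub>v n" using fn[OF u(1)] by (intro eq_vecI) auto
        with u show False by simp
      qed
      with fsum u show ?thesis by fastforce
    qed
    note terms = nonzero_ridge_terms[OF assms(1-4) data this]
    obtain w' v' g' where
      new: "\<forall>k<r. ridge_data n m d (w' k) (v' k) (g' k) \<and>
        (\<exists>u\<in>carrier_vec m. \<exists>i<n. w' k $ i * poly (g' k) (v' k \<bullet> u) \<noteq> 0)"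
      and sum': "\<forall>u\<in>carrier_vec m. \<forall>i<n. (\<Sum>k<r. w' k $ i * poly (g' k) (v' k \<bullet> u)) =
        (\<Sum>k<r. w k $ i * poly (g k) (v k \<bullet> u))"
      using terms by blast
    have data': "ridge_data n m d (w' k) (v' k) (g' k)"
      and nz': "\<exists>u\<in>carrier_vec m. \<exists>i<n. w' k $ i * poly (g' k) (v' k \<bullet> u) \<noteq> 0" if "k < r" for k
      using new that by simp_all
    define p where "p = (\<lambda>k u. poly (g' k) (v' k \<bullet> u) \<cdot>\<^sub>v w' k)"
    have p_index: "p k u $ i = w' k $ i * poly (g' k) (v' k \<bullet> u)" if "k < r" "i < n" for k u i
      using carrier_vecD[OF conjunct1[OF data'[OF that(1)]]] that by (simp add: p_def)
    have rp: "ridge_map n m d (w' k) (v' k) (g' k) (p k)" if "k < r" for k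
      using data'[OF that] p_index that by (auto simp: ridge_map_def p_def)
    then have pp: "p k \<in> polynomial_maps n m d" if "k < r" for k
      using ridge_map_polynomial that by blast
    have "f u $ i = (\<Sum>k<r. p k u $ i)" if "u \<in> carrier_vec m" "i < n" for u i
      using fsum[OF that] sum' p_index that by simp
    then have "\<Phi> f = tensor_sum r (\<lambda>k. \<Phi> (p k))"
      using sum_iff[OF f, of r p] pp by blast
    moreover have "cp_rank n m K (\<Phi> (p k)) = 1" if k: "k < r" for k
    proof -
      obtain a b c where abc: "a \<in> carrier_vec n" "b \<in> carrier_vec m" "c \<in> carrier_vec K"
        "\<Phi> (p k) = outer3 a b c" using outer3[OF rp[OF k]] by blast
      \<comment> \<open>With no summands, \<open>sum_iff\<close> says that only a vanishing map has
        the zero tensor.\<close>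
      have "\<Phi> (p k) \<noteq> tensor_sum 0 (\<lambda>k. \<Phi> (p k))"
        using sum_iff[OF pp[OF k], of 0 p] nz'[OF k] p_index[OF k] by auto
      then have "outer3 a b c \<noteq> (\<lambda>i j k. 0)" by (simp add: abc tensor_sum_def)
      from cp_rank_outer3[OF abc(1-3) this] show ?thesis by (simp add: abc)
    qed
    ultimately show ?R using pp by (intro exI[of _ "\<lambda>k. \<Phi> (p k)"]) auto
  qed
  show ?L if ?R
  proof -
    obtain T where T: "\<Phi> f = tensor_sum r T"
      and Tk: "\<And>k. k < r \<Longrightarrow> cp_rank n m K (T k) = 1 \<and> T k \<in> \<Phi> ` polynomial_maps n m d"
      using \<open>?R\<close> by blast
    have "\<forall>k. \<exists>p w v g. k < r \<longrightarrow> T k = \<Phi> p \<and> p \<in> polynomial_maps n m d \<and> ridge_map n m d w v g p"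
    proof
      fix k
      show "\<exists>p w v g. k < r \<longrightarrow> T k = \<Phi> p \<and> p \<in> polynomial_maps n m d \<and> ridge_map n m d w v g p"
      proof (cases "k < r")
        case True
        then obtain p where p: "p \<in> polynomial_maps n m d" "T k = \<Phi> p" using Tk by blast
        obtain F where "T k = tensor3 n m K F" using shape p by metis
        then obtain a b c where "a \<in> carrier_vec n" "b \<in> carrier_vec m" "c \<in> carrier_vec K"
          "\<Phi> p = outer3 a b c" using cp_rank_1_imp_outer3[of n m K "T k" F] Tk[OF True] p by auto
        with ridge[OF p(1)] p show ?thesis by blast
      qed simp
    qed
    then obtain p w v g where pw: "\<And>k. k < r \<Longrightarrow>
        T k = \<Phi> (p k) \<and> p k \<in> polynomial_maps n m d \<and> ridge_map n m d (w k) (v k) (g k) (p k)"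
      by metis
    have "tensor_sum r T = tensor_sum r (\<lambda>k. \<Phi> (p k))"
      unfolding tensor_sum_def using pw by (intro ext sum.cong) auto
    then have "f u $ i = (\<Sum>k<r. p k u $ i)" if "u \<in> carrier_vec m" "i < n" for u i
      using sum_iff[OF f, of r p] T pw that by auto
    moreover have "p k u $ i = w k $ i * poly (g k) (v k \<bullet> u)"
      if "k < r" "u \<in> carrier_vec m" "i < n" for k u i
      using pw[OF that(1)] that by (simp add: ridge_map_def)
    ultimately have "f u $ i = (\<Sum>k<r. w k $ i * poly (g k) (v k \<bullet> u))"
      if "u \<in> carrier_vec m" "i < n" for u i
      using that by simp
    moreover have data: "ridge_data n m d (w k) (v k) (g k)" if "k < r" for k
      using pw[OF that] by (simp add: ridge_map_def)
    ultimately have "f u = finsum_vec TYPE(real) n (\<lambda>k. poly (g k) (v k \<bullet> u) \<cdot>\<^sub>v w k) {..<r}"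
      if "u \<in> carrier_vec m" for u
      using eq_finsum_vec_ridge_iff[OF fn[OF that], of r w g v u] that by blast
    with data show ?L by blast
  qed
qed

theorem corollary2:
  fixes m n d N r :: nat
    and U :: "nat \<Rightarrow> real vec"
    and f :: "real vec \<Rightarrow> real vec"
  assumes "m \<ge> 1" and "n \<ge> 1" and "d \<ge> 1" and "N \<ge> 1" and "r \<ge> 1"
    and "\<forall>l<N. U l \<in> carrier_vec m"
    and "vec_space.rank (Delta m d) (vandermonde_mat m d N U) = (m + d - 1) choose (d - 1)"
    and "f \<in> polynomial_maps n m d"
    and "r = 1 \<Longrightarrow> \<exists>u \<in> carrier_vec m. f u \<noteq> 0\<^sub>v n"
  defines "decomposition \<equiv>
      (\<exists>(w :: nat \<Rightarrow> real vec) (v :: nat \<Rightarrow> real vec) (g :: nat \<Rightarrow> real poly).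
         (\<forall>k<r. w k \<in> carrier_vec n \<and> v k \<in> carrier_vec m \<and>
                degree (g k) \<le> d \<and> coeff (g k) 0 = 0) \<and>
         (\<forall>u \<in> carrier_vec m.
            f u = finsum_vec TYPE(real) n (\<lambda>k. poly (g k) (v k \<bullet> u) \<cdot>\<^sub>v w k) {..<r}))"
    and "Q_decomposition \<equiv>
      (\<exists>Q :: nat \<Rightarrow> tensor3.
         Q_tensor n m d f = tensor_sum r Q \<and>
         (\<forall>k<r. cp_rank n m (Delta m d) (Q k) = 1 \<and> Q k \<in> Q_space n m d))"
    and "J_decomposition \<equiv>
      (\<exists>J :: nat \<Rightarrow> tensor3.
         J_tensor n m N U f = tensor_sum r J \<and>
         (\<forall>k<r. cp_rank n m N (J k) = 1 \<and> J k \<in> J_space n m d N U))"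
  shows "(decomposition \<longleftrightarrow> Q_decomposition) \<and> (Q_decomposition \<longleftrightarrow> J_decomposition)"
proof -
  interpret sampling m d N U using assms(1,3,6,7) by unfold_locales
  have "decomposition \<longleftrightarrow> Q_decomposition"
    unfolding decomposition_def Q_decomposition_def Q_space_def
    by (rule ridge_decomposition_iff[OF assms(2,1,3,5,8,9) Q_tensor_sum_iff[OF assms(1)] _
          ridge_map_Q_tensor_outer3[OF assms(1)] Q_tensor_outer3_imp_ridge[OF assms(1)]])
      (auto simp: Q_tensor_def)
  moreover have "decomposition \<longleftrightarrow> J_decomposition"
    unfolding decomposition_def J_decomposition_def J_space_def
    by (rule ridge_decomposition_iff[OF assms(2,1,3,5,8,9) J_tensor_sum_iff _
          ridge_map_J_tensor_outer3[OF assms(6)] J_tensor_outer3_imp_ridge])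
      (auto simp: J_tensor_def)
  ultimately show ?thesis by blast
qed

end
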